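(* Let $X$ be a separable Banach space with an unconditional Schauder decomposition $X=\sum_{n=1}^{+\infty}E_n$ which is not perfect. Then there exist an integer $N$ and a constant $K$ such that, for every subset $I$ of $[N,\infty)$ (i.e. every set $I$ of integers $\ge N$), $X\sim^K X\oplus\left(\sum_{n\in I}E_n\right)$.
   Context: Banach spaces are real; $X\sim Y$ means $X$ and $Y$ are isomorphic (linearly homeomorphic), and for $K\ge1$, $X\sim^K Y$ means $X$ is $K$-isomorphic to $Y$ (there is an isomorphism $T$ of $X$ onto $Y$ with $\|T\|\,\|T^{-1}\|\le K$). Direct sums of two spaces carry a fixed standard norm, e.g. the maximum norm. $2^\omega$ is the Cantor space of $0$-$1$ sequences, here indexed by $n\in\mathbb N=\{1,2,\dots\}$. A Schauder decomposition $X=\sum_{n}E_n$ is a sequence of closed subspaces (not necessarily finite-dimensional) such that every $x\in X$ can be written uniquely as $x=\sum_n x_n$ with $x_n\in E_n$; it is unconditional if there is a constant $C$ such that $\|\sum_{n\in I}x_n\|\le C\|x\|$ for all $x=\sum_n x_n$ and all $I\subset\mathbb N$. For $I\subset\mathbb N$, $\sum_{n\in I}E_n$ is the closed subspace of those $x$ whose components $x_n$ vanish for $n\notin I$. The decomposition is perfect if there is a nonempty perfect subset $P$ of $2^\omega$ such that for all $\alpha\ne\beta$ in $P$: $\sum_{\alpha(n)=1}E_n\not\sim\sum_{\beta(n)=1}E_n$, $\sum_{\alpha(n)=0}E_n\not\sim\sum_{\beta(n)=1}E_n$ and $\sum_{\alpha(n)=0}E_n\not\sim\sum_{\beta(n)=0}E_n$.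 *)

theory Defs
  imports "HOL-Analysis.Analysis"
begin

text \<open>
  Banach spaces occur below as closed subspaces of an ambient space, so isomorphisms are maps
  that need only be linear and continuous on the subspace at hand.
  The direct sum of \<open>S\<close> and \<open>T\<close> is \<open>S \<times> T\<close> in the product type, whose norm is
  \<open>sqrt ((norm x)\<^sup>2 + (norm y)\<^sup>2)\<close>; the maximum norm is equivalent to it, with constant \<open>sqrt 2\<close>.
\<close>

definition linear_homeomorphism ::
  "'a::real_normed_vector set \<Rightarrow> 'b::real_normed_vector set \<Rightarrow> ('a \<Rightarrow> 'b) \<Rightarrow> ('b \<Rightarrow> 'a) \<Rightarrow> bool"
  where "linear_homeomorphism S T f g \<longleftrightarrow>
    (\<forall>x\<in>S. \<forall>y\<in>S. f (x + y) = f x + f y) \<and>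
    (\<forall>c. \<forall>x\<in>S. f (c *\<^sub>R x) = c *\<^sub>R f x) \<and>
    homeomorphism S T f g"

text \<open>
  The relative version of \<^const>\<open>onorm\<close>. The supremum is a genuine one whenever \<open>f\<close> is linear
  and continuous on the subspace \<open>S\<close>.
\<close>

definition onorm_on :: "'a::real_normed_vector set \<Rightarrow> ('a \<Rightarrow> 'b::real_normed_vector) \<Rightarrow> real"
  where "onorm_on S f = (SUP x\<in>S. norm (f x) / norm x)"

lemma onorm_on_UNIV: "onorm_on UNIV f = onorm f"
  by (simp add: onorm_on_def onorm_def)

definition isomorphic ::
  "'a::real_normed_vector set \<Rightarrow> 'b::real_normed_vector set \<Rightarrow> bool"
  where "isomorphic S T \<longleftrightarrow> (\<exists>f g. linear_homeomorphism S T f g)"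

definition K_isomorphic ::
  "real \<Rightarrow> 'a::real_normed_vector set \<Rightarrow> 'b::real_normed_vector set \<Rightarrow> bool"
  where "K_isomorphic K S T \<longleftrightarrow>
    (\<exists>f g. linear_homeomorphism S T f g \<and> onorm_on S f * onorm_on T g \<le> K)"

text \<open>
  Decompositions are indexed by \<open>{0, 1, 2, \<dots>}\<close> rather than \<open>{1, 2, \<dots>}\<close>.
\<close>

definition schauder_decomposition :: "(nat \<Rightarrow> 'a::banach set) \<Rightarrow> bool"
  where "schauder_decomposition E \<longleftrightarrow>
    (\<forall>n. subspace (E n) \<and> closed (E n)) \<and>
    (\<forall>x. \<exists>!u. (\<forall>n. u n \<in> E n) \<and> u sums x)"

definition component :: "(nat \<Rightarrow> 'a::banach set) \<Rightarrow> 'a \<Rightarrow> nat \<Rightarrow> 'a"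
  where "component E x = (THE u. (\<forall>n. u n \<in> E n) \<and> u sums x)"

text \<open>
  For infinite \<open>I\<close>, the bound on the norm of the partial sum over \<open>I\<close> includes the assertion
  that this series converges.
\<close>

definition unconditional_decomposition :: "(nat \<Rightarrow> 'a::banach set) \<Rightarrow> bool"
  where "unconditional_decomposition E \<longleftrightarrow>
    schauder_decomposition E \<and>
    (\<exists>C. \<forall>x I. summable (\<lambda>n. if n \<in> I then component E x n else 0) \<and>
       norm (\<Sum>n. if n \<in> I then component E x n else 0) \<le> C * norm x)"

definition partial_sum_space :: "(nat \<Rightarrow> 'a::banach set) \<Rightarrow> nat set \<Rightarrow> 'a set"
  where "partial_sum_space E I = {x. \<forall>n. n \<notin> I \<longrightarrow> component E x n = 0}"

text \<open>
  The Cantor space is the type \<^typ>\<open>nat \<Rightarrow> bool\<close> with its product topology, \<open>True\<close> standing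
  for 1 and \<open>False\<close> for 0.
\<close>

definition perfect_set :: "'a::topological_space set \<Rightarrow> bool"
  where "perfect_set P \<longleftrightarrow> closed P \<and> (\<forall>x\<in>P. x islimpt P)"

definition perfect_decomposition :: "(nat \<Rightarrow> 'a::banach set) \<Rightarrow> bool"
  where "perfect_decomposition E \<longleftrightarrow>
    (\<exists>P :: (nat \<Rightarrow> bool) set. P \<noteq> {} \<and> perfect_set P \<and>
      (\<forall>\<alpha>\<in>P. \<forall>\<beta>\<in>P. \<alpha> \<noteq> \<beta> \<longrightarrow>
        \<not> isomorphic (partial_sum_space E {n. \<alpha> n}) (partial_sum_space E {n. \<beta> n}) \<and>
        \<not> isomorphic (partial_sum_space E {n. \<not> \<alpha> n}) (partial_sum_space E {n. \<beta> n}) \<and>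
        \<not> isomorphic (partial_sum_space E {n. \<not> \<alpha> n}) (partial_sum_space E {n. \<not> \<beta> n})))"

end

(* Index the sums by subsets of the natural numbers, and let X_T be the sum over T. The pairs
   (T, T') with X_T isomorphic to X_T', or the same after complementing T or T', form a countable union
   of projections of closed sets, one for each isomorphism constant. If this union were meager,
   Mycielski's theorem would give a perfect set of pairwise unrelated sets T, and the decomposition
   would be perfect. So one of the projections is non-meager, hence comeager in some cylinder. Reading
   off a generic first coordinate gives a space Y and a pattern c such that X_T is K-isomorphic to Y
   whenever T agrees with c below N and on infinitely many of the intervals of some partition of
   [N, infinity). Keeping the pattern on the even intervals leaves T free on the odd ones, so that Y
   absorbs X_I for I inside the odd intervals; symmetrically for the even ones. Hence Y absorbs every
   X_I with I inside [N, infinity), and so does X, in which X_c, a copy of Y, is complemented. *)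
theory Submission
  imports Defs
begin

section \<open>Baire category in sequence spaces\<close>

text \<open>Isomorphism of two partial sums is only a projection of closed conditions, and a
  non-meager set alone supplies no usable pattern; the Baire property of such projections is what
  turns non-meager into comeager in a cylinder. It needs witnesses in a separable complete space, so
  an isomorphism is coded by a sequence in the square of the space that spans a dense part of its
  graph; separability enters here. Unconditionality makes the code closed, because the projections
  onto partial sums are uniformly bounded and depend continuously on the index set. Uniformity of
  the final constant has its origin in category: isomorphism constants may be taken to be integers,
  so a single integer belongs to the non-meager class, and afterwards only a fixed finite number of
  isomorphisms is composed. No Kuratowski-Ulam argument is needed to fix the first coordinate. A
  comeager set of pairs contains every pair that matches a certain pattern on infinitely many
  blocks; if the first coordinate equals the pattern everywhere, only the second one has to match on
  those blocks.\<close>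

definition cyl :: "'c list \<Rightarrow> (nat \<Rightarrow> 'c) set" where
  "cyl s = {\<gamma>. \<forall>i<length s. \<gamma> i = s ! i}"

text \<open>The topology meant here is the product of discrete topologies, for which the cylinders form a base.\<close>

definition nwd :: "(nat \<Rightarrow> 'c) set \<Rightarrow> bool" where
  "nwd S \<longleftrightarrow> (\<forall>s. \<exists>t. cyl (s @ t) \<inter> S = {})"

definition meager :: "(nat \<Rightarrow> 'c) set \<Rightarrow> bool" where
  "meager S \<longleftrightarrow> (\<exists>F :: nat \<Rightarrow> _. (\<forall>n. nwd (F n)) \<and> S \<subseteq> (\<Union>n. F n))"

lemma cyl_Nil [simp]: "cyl [] = UNIV"
  by (simp add: cyl_def)

lemma cyl_append: "\<gamma> \<in> cyl (s @ t) \<longleftrightarrow> \<gamma> \<in> cyl s \<and> (\<forall>i<length t. \<gamma> (length s + i) = t ! i)"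
proof -
  have "(\<forall>i<length s + length t. \<gamma> i = (s @ t) ! i) \<longleftrightarrow>
      (\<forall>i<length s. \<gamma> i = (s @ t) ! i) \<and> (\<forall>i<length t. \<gamma> (length s + i) = (s @ t) ! (length s + i))"
    (is "?l \<longleftrightarrow> ?r")
  proof
    assume r: ?r
    show ?l
    proof (intro allI impI)
      fix i assume "i < length s + length t"
      then show "\<gamma> i = (s @ t) ! i"
        using r le_Suc_ex[of "length s" i] by (cases "i < length s") auto
    qed
  qed auto
  then show ?thesis
    by (simp add: cyl_def nth_append)
qed

lemma cyl_append_subset: "cyl (s @ t) \<subseteq> cyl s"
  by (auto simp: cyl_append)

lemma map_mem_cyl [simp]: "\<gamma> \<in> cyl (map \<gamma> [0..<n])"
  by (simp add: cyl_def)

lemma mem_cyl_map_iff: "\<delta> \<in> cyl (map \<gamma> [0..<n]) \<longleftrightarrow> (\<forall>i<n. \<delta> i = \<gamma> i)"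
  by (simp add: cyl_def)

lemma mem_cyl_iff_map: "\<gamma> \<in> cyl s \<longleftrightarrow> map \<gamma> [0..<length s] = s"
  by (auto simp: cyl_def list_eq_iff_nth_eq[of _ s])

lemma mem_cyl_extend:
  assumes "\<gamma> \<in> cyl s" "length s \<le> n"
  obtains t where "map \<gamma> [0..<n] = s @ t"
proof
  have "[0..<n] = [0..<length s] @ [length s..<n]"
    using upt_add_eq_append[of 0 "length s" "n - length s"] assms(2) by simp
  then show "map \<gamma> [0..<n] = s @ map \<gamma> [length s..<n]"
    using assms(1) by (simp add: mem_cyl_iff_map)
qed

lemma nwd_Un:
  assumes "nwd A" "nwd B"
  shows "nwd (A \<union> B)"
  unfolding nwd_def
proof
  fix s
  obtain t where t: "cyl (s @ t) \<inter> A = {}"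
    using assms(1) by (auto simp: nwd_def)
  obtain t' where t': "cyl ((s @ t) @ t') \<inter> B = {}"
    using assms(2) unfolding nwd_def by blast
  have "cyl (s @ (t @ t')) \<inter> (A \<union> B) = {}"
    using t t' cyl_append_subset[of "s @ t" t'] by auto
  then show "\<exists>t. cyl (s @ t) \<inter> (A \<union> B) = {}" ..
qed

lemma nwd_empty [simp]: "nwd {}"
  by (simp add: nwd_def)

lemma nwd_UN_atMost:
  assumes "\<And>i. nwd (F i)"
  shows "nwd (\<Union>i\<le>n::nat. F i)"
  by (induction n) (auto simp: atMost_Suc intro: nwd_Un assms)

lemma meager_subset: "meager B \<Longrightarrow> A \<subseteq> B \<Longrightarrow> meager A"
  unfolding meager_def by (meson subset_trans)

lemma nwd_imp_meager: "nwd A \<Longrightarrow> meager A"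
  unfolding meager_def by (rule exI[of _ "\<lambda>_. A"]) auto

lemma meager_UN:
  assumes "countable I" "\<And>i. i \<in> I \<Longrightarrow> meager (A i)"
  shows "meager (\<Union>i\<in>I. A i)"
proof (cases "I = {}")
  case True
  then show ?thesis by (simp add: nwd_imp_meager)
next
  case False
  have "\<exists>F. (\<forall>n. nwd (F n)) \<and> A i \<subseteq> (\<Union>n::nat. F n)" if "i \<in> I" for i
    using assms(2)[OF that] by (simp add: meager_def)
  then obtain F where F: "\<And>i n. i \<in> I \<Longrightarrow> nwd (F i n)" "\<And>i. i \<in> I \<Longrightarrow> A i \<subseteq> (\<Union>n::nat. F i n)"
    by metis
  define f where "f = from_nat_into I"
  have f: "range f = I"
    using assms(1) False by (simp add: f_def range_from_nat_into)
  define H where "H n = F (f (fst (prod_decode n))) (snd (prod_decode n))" for n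
  have "nwd (H n)" for n
    using F(1) f unfolding H_def by blast
  moreover have "(\<Union>i\<in>I. A i) \<subseteq> (\<Union>n. H n)"
  proof
    fix x assume "x \<in> (\<Union>i\<in>I. A i)"
    then obtain i where i: "i \<in> I" "x \<in> A i" by blast
    with F(2) obtain n where n: "x \<in> F i n" by blast
    obtain j where "i = f j" using f i by blast
    then have "x \<in> H (prod_encode (j, n))"
      using n by (simp add: H_def)
    then show "x \<in> (\<Union>n. H n)" by blast
  qed
  ultimately show ?thesis
    unfolding meager_def by blast
qed

lemma meager_Un: "meager A \<Longrightarrow> meager B \<Longrightarrow> meager (A \<union> B)"
  using meager_UN[of "UNIV :: bool set" "\<lambda>b. if b then A else B"]
  by (auto simp: UNIV_bool Un_commute)

section \<open>Local category and the Baire property of projections\<close>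

text \<open>Otherwise the cylinders in which \<open>S\<close> is meager are dense below
  \<open>s\<close>. Their union then covers \<open>cyl s\<close> up to a nowhere dense set, and
  there are only countably many words, so \<open>S\<close> would be meager in
  \<open>cyl s\<close>.\<close>

lemma nonmeager_hereditarily:
  fixes S :: "(nat \<Rightarrow> 'c::countable) set"
  assumes "\<not> meager (S \<inter> cyl s)"
  shows "\<exists>t. \<forall>r. \<not> meager (S \<inter> cyl (s @ t @ r))"
proof (rule ccontr)
  assume "\<not> ?thesis"
  then have small: "\<exists>r. meager (S \<inter> cyl (s @ t @ r))" for t by blast
  define U where "U = (\<Union>r\<in>{r. meager (S \<inter> cyl r)}. cyl r)"
  have "nwd (cyl s - U)"
    unfolding nwd_def
  proof
    fix q :: "'c list"
    show "\<exists>t. cyl (q @ t) \<inter> (cyl s - U) = {}"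
    proof (cases "cyl (q @ replicate (length s) undefined) \<inter> (cyl s - U) = {}")
      case False
      then obtain \<gamma> where \<gamma>: "\<gamma> \<in> cyl q" "\<gamma> \<in> cyl s"
        by (auto simp: cyl_append)
      define n where "n = max (length q) (length s)"
      obtain t where t: "map \<gamma> [0..<n] = s @ t"
        using mem_cyl_extend[OF \<gamma>(2), of n] n_def by auto
      obtain t' where t': "map \<gamma> [0..<n] = q @ t'"
        using mem_cyl_extend[OF \<gamma>(1), of n] n_def by auto
      obtain r where "meager (S \<inter> cyl (s @ t @ r))" using small by blast
      then have "cyl (q @ (t' @ r)) \<subseteq> U"
        unfolding U_def using t t' by (metis (mono_tags) UN_upper append.assoc mem_Collect_eq)
      then show ?thesis by blast
    qed blast
  qed
  moreover have "meager (\<Union>r\<in>{r. meager (S \<inter> cyl r)}. S \<inter> cyl r)"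
    by (rule meager_UN) auto
  moreover have "S \<inter> cyl s \<subseteq> (cyl s - U) \<union> (\<Union>r\<in>{r. meager (S \<inter> cyl r)}. S \<inter> cyl r)"
    by (auto simp: U_def)
  ultimately show False
    using assms meager_subset meager_Un nwd_imp_meager by metis
qed

text \<open>The classical set of points at which \<open>S\<close> is locally of second category. A
  heavy point need not belong to \<open>S\<close>, but it is a limit of points of \<open>S\<close>,
  and this survives passing to pieces of a countable cover.\<close>

definition heavy :: "(nat \<Rightarrow> 'c) set \<Rightarrow> (nat \<Rightarrow> 'c) set" where
  "heavy S = {\<gamma>. \<forall>n. \<not> meager (S \<inter> cyl (map \<gamma> [0..<n]))}"

lemma mem_heavyI:
  assumes "\<And>r. \<not> meager (S \<inter> cyl (s @ r))" "\<gamma> \<in> cyl s"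
  shows "\<gamma> \<in> heavy S"
proof -
  have "\<not> meager (S \<inter> cyl (map \<gamma> [0..<n]))" for n
  proof
    assume m: "meager (S \<inter> cyl (map \<gamma> [0..<n]))"
    obtain t where t: "map \<gamma> [0..<max n (length s)] = s @ t"
      using mem_cyl_extend[OF assms(2), of "max n (length s)"] by auto
    have "cyl (map \<gamma> [0..<max n (length s)]) \<subseteq> cyl (map \<gamma> [0..<n])"
      by (auto simp: mem_cyl_map_iff)
    then have "meager (S \<inter> cyl (s @ t))"
      using t by (metis m inf_mono meager_subset order_refl)
    then show False using assms(1) by blast
  qed
  then show ?thesis by (simp add: heavy_def)
qed

text \<open>A cylinder in which \<open>S\<close> is meager contains no heavy point of
  \<open>S\<close>. In any other cylinder some \<open>T n\<close> is non-meager, hence heavy at all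
  points of a smaller cylinder.\<close>

lemma heavy_UN:
  fixes S :: "(nat \<Rightarrow> 'c::countable) set"
  assumes "S \<subseteq> (\<Union>n::nat. T n)"
  shows "nwd (heavy S - (\<Union>n. heavy (T n)))"
  unfolding nwd_def
proof
  fix s :: "'c list"
  show "\<exists>t. cyl (s @ t) \<inter> (heavy S - (\<Union>n. heavy (T n))) = {}"
  proof (cases "meager (S \<inter> cyl s)")
    case True
    have "\<gamma> \<notin> heavy S" if "\<gamma> \<in> cyl s" for \<gamma>
      using that True by (metis (mono_tags, lifting) heavy_def mem_Collect_eq mem_cyl_iff_map)
    then have "cyl (s @ []) \<inter> (heavy S - (\<Union>n. heavy (T n))) = {}" by auto
    then show ?thesis ..
  next
    case False
    have "\<exists>n. \<not> meager (T n \<inter> cyl s)"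
    proof (rule ccontr)
      assume "\<not> ?thesis"
      then have "meager (\<Union>n. T n \<inter> cyl s)" by (intro meager_UN) auto
      then have "meager (S \<inter> cyl s)" by (rule meager_subset) (use assms in blast)
      then show False using False by blast
    qed
    then obtain n t where "\<And>r. \<not> meager (T n \<inter> cyl (s @ t @ r))"
      using nonmeager_hereditarily by metis
    then have "cyl (s @ t) \<subseteq> heavy (T n)"
      using mem_heavyI[of "T n" "s @ t"] by auto
    then have "cyl (s @ t) \<inter> (heavy S - (\<Union>n. heavy (T n))) = {}" by blast
    then show ?thesis ..
  qed
qed

text \<open>The projection of a closed set has the Baire property (Nikodym). The projected set is covered by the
  pieces \<open>T p\<close> on which the first entries of the witness are located near points of a
  dense sequence, entry \<open>i\<close> of \<open>p\<close> coding a coordinate together with a precision. Outside the meager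
  set \<open>M\<close> a point where \<open>T []\<close> is heavy admits a whole branch of heavy pieces, and the witnesses along
  this branch converge.\<close>

lemma analytic_comeager_in_cyl:
  fixes R :: "(nat \<Rightarrow> 'c::countable) \<Rightarrow> (nat \<Rightarrow> 'w::complete_space) \<Rightarrow> bool"
  assumes D: "countable D" "closure D = (UNIV :: 'w set)"
    and closed: "\<And>\<gamma>s \<gamma> ws w. \<lbrakk>\<And>j. R (\<gamma>s j) (ws j); \<And>i. eventually (\<lambda>j. \<gamma>s j i = \<gamma> i) sequentially;
        \<And>k. (\<lambda>j. ws j k) \<longlonglongrightarrow> w k\<rbrakk> \<Longrightarrow> R \<gamma> w"
    and nonmeager: "\<not> meager {\<gamma>. \<exists>w. R \<gamma> w}"
  shows "\<exists>s. meager (cyl s - {\<gamma>. \<exists>w. R \<gamma> w})"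
proof -
  define d where "d = from_nat_into D"
  have "D \<noteq> {}" using D(2) by auto
  then have d: "range d = D" using D(1) by (simp add: d_def range_from_nat_into)
  have dense: "\<exists>n. dist x (d n) \<le> e" if e: "e > 0" for x e
  proof -
    have "x \<in> closure D" using D(2) by simp
    then obtain y where "y \<in> D" "dist y x < e" using e closure_approachable[of x D] by blast
    moreover obtain n where "y = d n" using d \<open>y \<in> D\<close> by blast
    ultimately show ?thesis by (intro exI[of _ n]) (simp add: dist_commute)
  qed
  define T where "T p = {\<gamma>. \<exists>w. R \<gamma> w \<and> (\<forall>i<length p. 
    dist (w (fst (prod_decode i))) (d (p ! i)) \<le> (1/2) ^ snd (prod_decode i))}" for p
  have T_split: "T p \<subseteq> (\<Union>n. T (p @ [n]))" for p
  proof
    fix \<gamma> assume "\<gamma> \<in> T p"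
    then obtain w where w: "R \<gamma> w" "\<forall>i<length p. 
      dist (w (fst (prod_decode i))) (d (p ! i)) \<le> (1/2) ^ snd (prod_decode i)"
      by (auto simp: T_def)
    obtain n where "dist (w (fst (prod_decode (length p)))) (d n) \<le> (1/2) ^ snd (prod_decode (length p))"
      using dense[of "(1/2) ^ snd (prod_decode (length p))"] by auto
    then have "\<gamma> \<in> T (p @ [n])"
      using w by (auto simp: T_def nth_append less_Suc_eq intro!: exI[of _ w])
    then show "\<gamma> \<in> (\<Union>n. T (p @ [n]))" by blast
  qed
  define M where "M = (\<Union>p. heavy (T p) - (\<Union>n. heavy (T (p @ [n]))))"
  have M: "meager M"
    unfolding M_def by (intro meager_UN nwd_imp_meager heavy_UN T_split) auto
  have T_Nil: "T [] = {\<gamma>. \<exists>w. R \<gamma> w}" by (auto simp: T_def)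
  have "\<not> meager (T [] \<inter> cyl [])" using nonmeager T_Nil by simp
  from nonmeager_hereditarily[OF this] obtain s where s: "\<And>r. \<not> meager (T [] \<inter> cyl (s @ r))"
    by auto
  \<comment> \<open>By the choice of \<open>s\<close>, the piece \<open>T []\<close> is heavy at
    every point of \<open>cyl s\<close>, so a branch of heavy pieces can be started at each of
    them.\<close>
  have "cyl s - {\<gamma>. \<exists>w. R \<gamma> w} \<subseteq> M"
  proof (rule ccontr)
    assume "\<not> ?thesis"
    then obtain \<gamma> where \<gamma>: "\<gamma> \<in> cyl s" "\<nexists>w. R \<gamma> w" "\<gamma> \<notin> M" by blast
    have "\<exists>p. \<forall>n. (length (p n) = n \<and> \<gamma> \<in> heavy (T (p n))) \<and> (\<exists>a. p (Suc n) = p n @ [a])"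
    proof (rule dependent_nat_choice)
      show "\<exists>p. length p = 0 \<and> \<gamma> \<in> heavy (T p)"
        using mem_heavyI[OF s \<gamma>(1)] by auto
    next
      fix p n assume p: "length p = n \<and> \<gamma> \<in> heavy (T p)"
      then obtain a where "\<gamma> \<in> heavy (T (p @ [a]))" using \<gamma>(3) by (auto simp: M_def)
      then show "\<exists>q. (length q = Suc n \<and> \<gamma> \<in> heavy (T q)) \<and> (\<exists>a. q = p @ [a])"
        using p by (intro exI[of _ "p @ [a]"]) auto
    qed
    then obtain p where p: "\<And>n. length (p n) = n" "\<And>n. \<gamma> \<in> heavy (T (p n))"
      "\<And>n. \<exists>a. p (Suc n) = p n @ [a]" by blast
    have p_nth: "p (Suc i + j) ! i = p (Suc i) ! i" for i j
    proof (induction j)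
      case (Suc j)
      obtain a where "p (Suc (Suc i + j)) = p (Suc i + j) @ [a]" using p(3) by blast
      with Suc show ?case using p(1) by (simp add: nth_append)
    qed simp
    \<comment> \<open>Heaviness does not put \<open>\<gamma>\<close> itself into
      \<open>T (p n)\<close>; it gives points of \<open>T (p n)\<close> that share longer and longer
      initial segments with \<open>\<gamma>\<close>.\<close>
    have "\<exists>\<delta>. \<delta> \<in> T (p n) \<inter> cyl (map \<gamma> [0..<n])" for n
    proof (rule ccontr)
      assume "\<not> ?thesis"
      then have "meager (T (p n) \<inter> cyl (map \<gamma> [0..<n]))"
        by (metis equals0I nwd_empty nwd_imp_meager)
      then show False using p(2)[of n] by (auto simp: heavy_def)
    qed
    then obtain \<gamma>s where \<gamma>s: "\<And>n. \<gamma>s n \<in> T (p n)" "\<And>n. \<gamma>s n \<in> cyl (map \<gamma> [0..<n])"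
      by (metis Int_iff)
    have "\<forall>n. \<exists>w. R (\<gamma>s n) w \<and> (\<forall>i<n. 
      dist (w (fst (prod_decode i))) (d (p n ! i)) \<le> (1/2) ^ snd (prod_decode i))"
      using \<gamma>s(1) p(1) by (simp add: T_def)
    then obtain ws where ws: "\<And>n. R (\<gamma>s n) (ws n)" "\<And>n i. i < n \<Longrightarrow> 
      dist (ws n (fst (prod_decode i))) (d (p n ! i)) \<le> (1/2) ^ snd (prod_decode i)"
      by metis
    have "Cauchy (\<lambda>n. ws n k)" for k
      unfolding Cauchy_def
    proof (intro allI impI)
      fix e :: real assume "e > 0"
      then obtain l where l: "(1/2::real) ^ l < e / 2"
        using real_arch_pow_inv[of "e/2" "1/2"] by auto
      \<comment> \<open>Entry \<open>i\<close> of the branch controls coordinate \<open>k\<close> to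
        precision \<open>(1/2) ^ l\<close>, and it no longer changes once the branch is longer than
        \<open>i\<close>.\<close>
      define i where "i = prod_encode (k, l)"
      have close: "dist (ws n k) (d (p (Suc i) ! i)) < e / 2" if n: "n \<ge> Suc i" for n
      proof -
        have "dist (ws n k) (d (p n ! i)) \<le> (1/2) ^ l"
          using ws(2)[of i n] n by (simp add: i_def)
        moreover have "p n ! i = p (Suc i) ! i"
          using p_nth[of i "n - Suc i"] n by simp
        ultimately show ?thesis using l by simp
      qed
      show "\<exists>M. \<forall>m\<ge>M. \<forall>n\<ge>M. dist (ws m k) (ws n k) < e"
        using close by (metis dist_triangle_half_l)
    qed
    then have "\<exists>l. (\<lambda>n. ws n k) \<longlonglongrightarrow> l" for k
      unfolding convergent_def[symmetric] by (rule Cauchy_convergent)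
    then obtain w where w: "\<And>k. (\<lambda>n. ws n k) \<longlonglongrightarrow> w k" by metis
    have "R \<gamma> w"
    proof (rule closed[OF ws(1) _ w])
      fix i
      show "eventually (\<lambda>j. \<gamma>s j i = \<gamma> i) sequentially"
        unfolding eventually_sequentially
      proof (intro exI allI impI)
        fix j assume "Suc i \<le> j"
        then show "\<gamma>s j i = \<gamma> i" using \<gamma>s(2)[of j] by (simp add: mem_cyl_map_iff)
      qed
    qed
    then show False using \<gamma>(2) by blast
  qed
  then show ?thesis using M meager_subset by blast
qed

section \<open>Block patterns for meager sets, and perfect sets\<close>

text \<open>The words of \<open>Q\<close> are treated one at a time, lengthening a common
  continuation; lengthening keeps what was avoided before.\<close>

lemma nwd_avoid_words:
  assumes "nwd S" "finite Q"
  shows "\<exists>w. \<forall>s\<in>Q. cyl (s @ w) \<inter> S = {}"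
  using assms(2)
proof (induction Q)
  case (insert s Q)
  then obtain w where w: "\<forall>s\<in>Q. cyl (s @ w) \<inter> S = {}" by blast
  obtain t where t: "cyl ((s @ w) @ t) \<inter> S = {}" using assms(1) unfolding nwd_def by blast
  have "cyl (q @ (w @ t)) \<inter> S = {}" if "q \<in> Q" for q
    using w that cyl_append_subset[of "q @ w" t] by fastforce
  then show ?case using t by (intro exI[of _ "w @ t"]) auto
qed simp

text \<open>Over a finite alphabet there are finitely many pasts of a given length, so one word
  avoids the first \<open>n + 1\<close> nowhere dense sets after every past. Concatenating these
  words gives \<open>g\<close>. As the avoided sets increase with \<open>n\<close>, matching
  infinitely many blocks avoids them all.\<close>

lemma meager_blocks:
  fixes S :: "(nat \<Rightarrow> 'c::finite) set"
  assumes "meager S"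
  shows "\<exists>k g. strict_mono k \<and> k 0 = m \<and>
    (\<forall>\<gamma>. (\<exists>\<^sub>\<infinity>n. \<forall>i\<in>{k n..<k (Suc n)}. \<gamma> i = g i) \<longrightarrow> \<gamma> \<notin> S)"
proof -
  obtain F where F: "\<And>n::nat. nwd (F n)" "S \<subseteq> (\<Union>n. F n)"
    using assms by (auto simp: meager_def)
  define H where "H n = (\<Union>i\<le>n. F i)" for n
  have H: "nwd (H n)" for n unfolding H_def by (intro nwd_UN_atMost F)
  have "\<exists>z. \<forall>n. (n = 0 \<longrightarrow> length (z n) = m) \<and> (\<exists>w. z (Suc n) = z n @ w \<and> w \<noteq> [] \<and>
    (\<forall>s. length s = length (z n) \<longrightarrow> cyl (s @ w) \<inter> H n = {}))"
  proof (rule dependent_nat_choice)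
    \<comment> \<open>The first \<open>m\<close> entries are filler, since the blocks begin at
      \<open>m\<close>.\<close>
    show "\<exists>z. 0 = (0::nat) \<longrightarrow> length z = m" by (intro exI[of _ "replicate m undefined"]) simp
  next
    fix z :: "'c list" and n :: nat
    have "finite {s :: 'c list. length s = length z}"
      using finite_lists_length_eq[of "UNIV :: 'c set" "length z"] by simp
    from nwd_avoid_words[OF H[of n] this] obtain w
      where w: "\<forall>s. length s = length z \<longrightarrow> cyl (s @ w) \<inter> H n = {}" by auto
    \<comment> \<open>The extra letter makes the block nonempty, so that \<open>k\<close> increases
      strictly.\<close>
    define w' where "w' = w @ [undefined]"
    have "\<forall>s. length s = length z \<longrightarrow> cyl (s @ w') \<inter> H n = {}"
      using w cyl_append_subset[of "_ @ w" "[undefined]"] unfolding w'_def by fastforce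
    then show "\<exists>z'. (Suc n = 0 \<longrightarrow> length z' = m) \<and> (\<exists>w. z' = z @ w \<and> w \<noteq> [] \<and>
      (\<forall>s. length s = length z \<longrightarrow> cyl (s @ w) \<inter> H n = {}))"
      by (intro exI[of _ "z @ w'"]) (auto simp: w'_def)
  qed
  then obtain z where z0: "length (z 0) = m" and z: "\<And>n. \<exists>w. z (Suc n) = z n @ w \<and> w \<noteq> [] \<and>
    (\<forall>s. length s = length (z n) \<longrightarrow> cyl (s @ w) \<inter> H n = {})" by metis
  define k where "k n = length (z n)" for n
  have k: "strict_mono k"
    unfolding strict_mono_Suc_iff k_def using z by (metis length_append length_greater_0_conv less_add_same_cancel1)
  have z_nth: "z (n + j) ! i = z n ! i" if "i < k n" for n i j
  proof (induction j)
    case (Suc j)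
    have "k n \<le> k (n + j)" using k by (simp add: strict_mono_less_eq)
    then have "i < length (z (n + j))" using that by (simp add: k_def)
    moreover obtain w where "z (Suc (n + j)) = z (n + j) @ w" using z by blast
    ultimately show ?case using Suc by (simp add: nth_append)
  qed simp
  \<comment> \<open>The limit of the growing words: \<open>z (Suc i)\<close> has length at least
    \<open>Suc i\<close>, and its entries are never changed later.\<close>
  define g where "g i = z (Suc i) ! i" for i
  have g: "g i = z n ! i" if "i < k n" for i n
  proof -
    have "i < k (Suc i)" using strict_mono_imp_increasing[OF k, of "Suc i"] by simp
    then show ?thesis
      using z_nth[of i "Suc i" n] z_nth[of i n "Suc i"] that by (simp add: g_def add.commute)
  qed
  have avoid: "\<gamma> \<notin> H n" if agree: "\<forall>i\<in>{k n..<k (Suc n)}. \<gamma> i = g i" for \<gamma> n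
  proof -
    obtain w where w: "z (Suc n) = z n @ w"
      "\<forall>s. length s = length (z n) \<longrightarrow> cyl (s @ w) \<inter> H n = {}" using z by blast
    have "\<gamma> (k n + i) = w ! i" if "i < length w" for i
    proof -
      have "k n + i < k (Suc n)" using that w(1) by (simp add: k_def)
      then have "\<gamma> (k n + i) = z (Suc n) ! (k n + i)" using agree g by auto
      then show ?thesis using w(1) by (simp add: k_def)
    qed
    then have "\<gamma> \<in> cyl (map \<gamma> [0..<k n] @ w)"
      unfolding cyl_append by simp
    moreover have "cyl (map \<gamma> [0..<k n] @ w) \<inter> H n = {}" using w(2) by (simp add: k_def)
    ultimately show ?thesis by blast
  qed
  have "\<gamma> \<notin> S" if inf: "\<exists>\<^sub>\<infinity>n. \<forall>i\<in>{k n..<k (Suc n)}. \<gamma> i = g i" for \<gamma>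
  proof
    assume "\<gamma> \<in> S"
    then obtain l where l: "\<gamma> \<in> F l" using F(2) by blast
    obtain n where "n > l" "\<forall>i\<in>{k n..<k (Suc n)}. \<gamma> i = g i"
      using inf unfolding INFM_nat by blast
    with avoid have "\<gamma> \<notin> H n" by blast
    then show False using l \<open>n > l\<close> by (auto simp: H_def)
  qed
  then show ?thesis using k z0 k_def by blast
qed

text \<open>A version of Mycielski's theorem. Each block of \<open>meager_blocks\<close> codes a pair of words; on it, \<open>\<Phi> x\<close>
  copies the first or the second half of the generic pattern according to which of the two words \<open>x\<close>
  extends. Two distinct sequences are separated by infinitely many such pairs of words.\<close>

lemma meager_imp_perfect_square:
  fixes S :: "(nat \<Rightarrow> bool \<times> bool) set"
  assumes "meager S"
  shows "\<exists>\<Phi> :: (nat \<Rightarrow> bool) \<Rightarrow> nat \<Rightarrow> bool.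
    (\<forall>x y. x \<noteq> y \<longrightarrow> (\<lambda>i. (\<Phi> x i, \<Phi> y i)) \<notin> S) \<and>
    (\<forall>i. \<exists>m. \<forall>x y. (\<forall>j<m. x j = y j) \<longrightarrow> \<Phi> x i = \<Phi> y i)"
proof -
  obtain k :: "nat \<Rightarrow> nat" and g where k: "strict_mono k"
    and g: "\<And>\<gamma>. \<exists>\<^sub>\<infinity>n. \<forall>i\<in>{k n..<k (Suc n)}. \<gamma> i = g i \<Longrightarrow> \<gamma> \<notin> S"
    using meager_blocks[OF assms, of 0] by blast
  define blk where "blk i = (LEAST n. i < k (Suc n))" for i
  have blk: "blk i = n" if "i \<in> {k n..<k (Suc n)}" for i n
    unfolding blk_def
  proof (rule Least_equality)
    show "i < k (Suc n)" using that by simp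
    fix l assume "i < k (Suc l)"
    then have "k n < k (Suc l)" using that by simp
    then show "n \<le> l" using strict_mono_less[OF k] by simp
  qed
  define word1 word2 :: "nat \<Rightarrow> bool list"
    where "word1 n = fst (from_nat n :: bool list \<times> bool list)"
      and "word2 n = snd (from_nat n :: bool list \<times> bool list)" for n
  \<comment> \<open>The first word is tested first, so the second half is copied only by points that
    do not extend the first word. \<open>False\<close> is a filler.\<close>
  define \<Phi> where "\<Phi> x i = (if x \<in> cyl (word1 (blk i)) then fst (g i)
    else if x \<in> cyl (word2 (blk i)) then snd (g i) else False)" for x i
  have "(\<lambda>i. (\<Phi> x i, \<Phi> y i)) \<notin> S" if "x \<noteq> y" for x y
  proof (rule g)
    obtain j where j: "x j \<noteq> y j" using \<open>x \<noteq> y\<close> by blast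
    define code where "code m = to_nat (map x [0..<m], map y [0..<m])" for m
    have "inj code"
    proof
      fix m m' assume "code m = code m'"
      then have "map x [0..<m] = map x [0..<m']" by (simp add: code_def)
      then show "m = m'" by (metis diff_zero length_map length_upt)
    qed
    then have "infinite (code ` {j<..})"
      using infinite_Ioi[of j] by (simp add: finite_image_iff inj_on_subset)
    \<comment> \<open>For \<open>m > j\<close> the prefixes of length \<open>m\<close> differ, so
      \<open>x\<close> copies the first half and \<open>y\<close> the second on the block coding
      this pair of prefixes. Injectivity of \<open>code\<close> makes these blocks infinite in
      number.\<close>
    moreover have "code ` {j<..} \<subseteq> {n. \<forall>i\<in>{k n..<k (Suc n)}. (\<Phi> x i, \<Phi> y i) = g i}"
    proof safe
      fix m i assume m: "m > j" and "i \<in> {k (code m)..<k (Suc (code m))}"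
      then have "blk i = code m" using blk by blast
      then have "word1 (blk i) = map x [0..<m]" "word2 (blk i) = map y [0..<m]"
        by (simp_all add: word1_def word2_def code_def)
      moreover have "y \<notin> cyl (map x [0..<m])" using m j by (auto simp: mem_cyl_map_iff)
      ultimately show "(\<Phi> x i, \<Phi> y i) = g i" by (simp add: \<Phi>_def)
    qed
    ultimately show "\<exists>\<^sub>\<infinity>n. \<forall>i\<in>{k n..<k (Suc n)}. (\<Phi> x i, \<Phi> y i) = g i"
      unfolding INFM_iff_infinite using finite_subset by blast
  qed
  moreover have "\<exists>m. \<forall>x y. (\<forall>j<m. x j = y j) \<longrightarrow> \<Phi> x i = \<Phi> y i" for i
  proof -
    define m where "m = max (length (word1 (blk i))) (length (word2 (blk i)))"
    have "\<Phi> x i = \<Phi> y i" if "\<forall>j<m. x j = y j" for x y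
    proof -
      have "x \<in> cyl (word1 (blk i)) \<longleftrightarrow> y \<in> cyl (word1 (blk i))"
        "x \<in> cyl (word2 (blk i)) \<longleftrightarrow> y \<in> cyl (word2 (blk i))"
        using that by (auto simp: cyl_def m_def)
      then show ?thesis by (simp add: \<Phi>_def)
    qed
    then show ?thesis by blast
  qed
  ultimately show ?thesis by (intro exI[of _ \<Phi>]) simp
qed

lemma tendsto_eventually_eq_fun:
  fixes f :: "nat \<Rightarrow> nat \<Rightarrow> bool"
  assumes "\<And>i. eventually (\<lambda>j. f j i = l i) sequentially"
  shows "f \<longlonglongrightarrow> l"
proof -
  have "(\<lambda>j. f j i) \<longlonglongrightarrow> l i" for i
    by (rule tendsto_eventually[OF assms])
  then have "limitin (product_topology (\<lambda>i::nat. euclidean :: bool topology) UNIV) f l sequentially"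
    by (simp add: limitin_componentwise)
  then show ?thesis by (simp add: euclidean_product_topology)
qed

text \<open>The second hypothesis is continuity of \<open>\<Phi>\<close>, so its range is compact
  and hence closed; injectivity transfers the absence of isolated points from the Cantor space to
  the range.\<close>

lemma perfect_range:
  fixes \<Phi> :: "(nat \<Rightarrow> bool) \<Rightarrow> nat \<Rightarrow> bool"
  assumes "inj \<Phi>"
    and local: "\<And>i. \<exists>m. \<forall>x y. (\<forall>j<m. x j = y j) \<longrightarrow> \<Phi> x i = \<Phi> y i"
  shows "perfect_set (range \<Phi>)"
proof -
  have cont: "continuous_on UNIV \<Phi>"
  proof (rule continuous_on_coordinatewise_then_product)
    fix i
    obtain m where m: "\<And>x y. (\<forall>j<m. x j = y j) \<Longrightarrow> \<Phi> x i = \<Phi> y i" using local by blast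
    have "open ((\<lambda>x. \<Phi> x i) -` B)" for B
    proof (subst open_subopen, clarify)
      fix x assume x: "\<Phi> x i \<in> B"
      define U where "U = (\<Inter>j<m. (\<lambda>y. y j) -` {x j} :: (nat \<Rightarrow> bool) set)"
      have "open U" unfolding U_def
        by (intro open_INT finite_lessThan ballI open_vimage open_discrete
            continuous_on_product_coordinates)
      moreover have "x \<in> U" by (simp add: U_def)
      moreover have "U \<subseteq> (\<lambda>x. \<Phi> x i) -` B"
      proof
        fix y assume "y \<in> U"
        then have "\<Phi> y i = \<Phi> x i" by (intro m) (simp add: U_def)
        then show "y \<in> (\<lambda>x. \<Phi> x i) -` B" using x by simp
      qed
      ultimately show "\<exists>T. open T \<and> x \<in> T \<and> T \<subseteq> (\<lambda>x. \<Phi> x i) -` B" by blast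
    qed
    then show "continuous_on UNIV (\<lambda>x. \<Phi> x i)" by (simp add: continuous_on_open_vimage)
  qed
  have "compact_space (product_topology (\<lambda>i::nat. euclidean :: bool topology) UNIV)"
    unfolding compact_space_product_topology
    by (auto simp: compact_space_def compactin_euclidean_iff finite_imp_compact)
  then have "compact (UNIV :: (nat \<Rightarrow> bool) set)"
    by (simp add: euclidean_product_topology compact_space_def compactin_euclidean_iff)
  then have "compact (range \<Phi>)"
    using cont compact_continuous_image by blast
  have Hausdorff_bool: "Hausdorff_space (euclidean :: bool topology)"
    unfolding Hausdorff_space_def
  proof (intro allI impI)
    fix x y :: bool assume "x \<in> topspace euclidean \<and> y \<in> topspace euclidean \<and> x \<noteq> y"
    then show "\<exists>U V. openin euclidean U \<and> openin euclidean V \<and> x \<in> U \<and> y \<in> V \<and> disjnt U V"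
      by (intro exI[of _ "{x}"] exI[of _ "{y}"]) (auto intro: open_discrete)
  qed
  from \<open>compact (range \<Phi>)\<close>
  have "compactin (product_topology (\<lambda>i::nat. euclidean :: bool topology) UNIV) (range \<Phi>)"
    by (simp add: euclidean_product_topology compactin_euclidean_iff)
  then have "closedin (product_topology (\<lambda>i::nat. euclidean :: bool topology) UNIV) (range \<Phi>)"
    using Hausdorff_bool by (intro compactin_imp_closedin) (simp add: Hausdorff_space_product_topology)
  then have "closed (range \<Phi>)"
    by (simp add: euclidean_product_topology)
  moreover have "\<Phi> x islimpt range \<Phi>" for x
  proof (rule islimptI)
    fix T assume T: "\<Phi> x \<in> T" "open T"
    \<comment> \<open>Flipping entry \<open>n\<close> alone gives points different from
      \<open>x\<close> that converge to \<open>x\<close>.\<close>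
    define y where "y n = x(n := \<not> x n)" for n
    have "y \<longlonglongrightarrow> x"
    proof (rule tendsto_eventually_eq_fun)
      show "eventually (\<lambda>n. y n i = x i) sequentially" for i
        using eventually_gt_at_top[of i] by eventually_elim (simp add: y_def)
    qed
    then have "(\<lambda>n. \<Phi> (y n)) \<longlonglongrightarrow> \<Phi> x"
      by (rule continuous_on_tendsto_compose[OF cont]) auto
    from topological_tendstoD[OF this T(2,1)] obtain n where "\<Phi> (y n) \<in> T"
      by (auto simp: eventually_sequentially)
    moreover have "y n \<noteq> x" by (auto simp: y_def fun_eq_iff)
    ultimately show "\<exists>z\<in>range \<Phi>. z \<in> T \<and> z \<noteq> \<Phi> x"
      using assms(1) by (auto dest: injD)
  qed
  ultimately show ?thesis by (auto simp: perfect_set_def)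
qed

section \<open>Isomorphisms with uniform constants\<close>

text \<open>Isomorphisms are handled through their graphs: inversion and composition then become
  operations on subspaces of a product.\<close>

definition biso :: "real \<Rightarrow> 'a::real_normed_vector set \<Rightarrow> 'b::real_normed_vector set \<Rightarrow> bool" where
  "biso K S T \<longleftrightarrow> (\<exists>G. subspace G \<and> Domain G = S \<and> Range G = T \<and>
    (\<forall>x y. (x, y) \<in> G \<longrightarrow> norm x \<le> K * norm y \<and> norm y \<le> K * norm x))"

lemma bisoI:
  assumes "subspace G" "Domain G = S" "Range G = T"
    "\<And>x y. (x, y) \<in> G \<Longrightarrow> norm x \<le> K * norm y \<and> norm y \<le> K * norm x"
  shows "biso K S T"
  unfolding biso_def using assms by (intro exI[of _ G]) auto

lemma biso_mono:
  assumes "biso K S T" "K \<le> L"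
  shows "biso L S T"
proof -
  obtain G where G: "subspace G" "Domain G = S" "Range G = T"
    "\<And>x y. (x, y) \<in> G \<Longrightarrow> norm x \<le> K * norm y \<and> norm y \<le> K * norm x"
    using assms(1) unfolding biso_def by blast
  show ?thesis
  proof (rule bisoI[OF G(1-3)])
    fix x y assume "(x, y) \<in> G"
    moreover have "K * norm y \<le> L * norm y" "K * norm x \<le> L * norm x"
      using assms(2) by (simp_all add: mult_right_mono)
    ultimately show "norm x \<le> L * norm y \<and> norm y \<le> L * norm x"
      using G(4)[of x y] by simp
  qed
qed

lemma biso_sym:
  assumes "biso K S T"
  shows "biso K T S"
proof -
  obtain G where G: "subspace G" "Domain G = S" "Range G = T"
    "\<And>x y. (x, y) \<in> G \<Longrightarrow> norm x \<le> K * norm y \<and> norm y \<le> K * norm x"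
    using assms unfolding biso_def by blast
  have "subspace (G\<inverse>)"
    using subspace_0[OF G(1)] subspace_add[OF G(1)] subspace_scale[OF G(1)]
    by (fastforce simp: subspace_def zero_prod_def)
  then show ?thesis
    by (rule bisoI) (use G in auto)
qed

lemma biso_trans:
  assumes "biso K S T" "biso L T U" "K \<ge> 0" "L \<ge> 0"
  shows "biso (K * L) S U"
proof -
  obtain G where G: "subspace G" "Domain G = S" "Range G = T"
    "\<And>x y. (x, y) \<in> G \<Longrightarrow> norm x \<le> K * norm y \<and> norm y \<le> K * norm x"
    using assms(1) unfolding biso_def by blast
  obtain H where H: "subspace H" "Domain H = T" "Range H = U"
    "\<And>x y. (x, y) \<in> H \<Longrightarrow> norm x \<le> L * norm y \<and> norm y \<le> L * norm x"
    using assms(2) unfolding biso_def by blast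
  have "subspace (G O H)"
    unfolding subspace_def
  proof safe
    show "0 \<in> G O H"
      using subspace_0[OF G(1)] subspace_0[OF H(1)] by (auto simp: zero_prod_def)
  next
    fix x y z x' y' z' assume "(x, y) \<in> G" "(y, z) \<in> H" "(x', y') \<in> G" "(y', z') \<in> H"
    then show "(x, z) + (x', z') \<in> G O H"
      using subspace_add[OF G(1), of "(x, y)" "(x', y')"] subspace_add[OF H(1), of "(y, z)" "(y', z')"]
      by auto
  next
    fix c x y z assume "(x, y) \<in> G" "(y, z) \<in> H"
    then show "c *\<^sub>R (x, z) \<in> G O H"
      using subspace_scale[OF G(1), of "(x, y)" c] subspace_scale[OF H(1), of "(y, z)" c] by auto
  qed
  moreover have "Domain (G O H) = S" "Range (G O H) = U"
    using G(2,3) H(2,3) by blast+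
  moreover have "norm x \<le> K * L * norm z \<and> norm z \<le> K * L * norm x" if "(x, z) \<in> G O H" for x z
  proof -
    from that obtain y where "(x, y) \<in> G" "(y, z) \<in> H" by blast
    then have "norm x \<le> K * norm y" "norm y \<le> K * norm x" "norm y \<le> L * norm z" "norm z \<le> L * norm y"
      using G(4) H(4) by blast+
    moreover have "K * norm y \<le> K * (L * norm z)" "L * norm y \<le> L * (K * norm x)"
      using calculation assms(3,4) by (auto intro: mult_left_mono)
    ultimately show ?thesis by (simp add: mult.assoc mult.left_commute)
  qed
  ultimately show ?thesis by (rule bisoI)
qed

lemma norm_Pair_le_scale:
  assumes "norm x \<le> K * norm x'" "norm y \<le> K * norm y'" "K \<ge> 0"
  shows "norm (x, y) \<le> K * norm (x', y')"
proof -
  have "(norm x)\<^sup>2 + (norm y)\<^sup>2 \<le> (K * norm x')\<^sup>2 + (K * norm y')\<^sup>2"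
    using assms by (intro add_mono power_mono) auto
  then have "norm (x, y) \<le> sqrt (K\<^sup>2 * ((norm x')\<^sup>2 + (norm y')\<^sup>2))"
    by (simp add: norm_Pair algebra_simps power_mult_distrib)
  then show ?thesis using assms(3) by (simp add: norm_Pair real_sqrt_mult)
qed

lemma biso_linear_image:
  assumes "linear f" "subspace S"
    and "\<And>x. x \<in> S \<Longrightarrow> norm x \<le> K * norm (f x) \<and> norm (f x) \<le> K * norm x"
  shows "biso K S (f ` S)"
  unfolding biso_def
proof (intro exI conjI)
  show "subspace ((\<lambda>x. (x, f x)) ` S)"
    using assms(1,2) by (intro linear_subspace_image) (auto simp: linear_iff)
qed (use assms(3) in auto)

lemma biso_times:
  assumes "biso K S T" "biso K U V" "K \<ge> 0"
  shows "biso K (S \<times> U) (T \<times> V)"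
proof -
  obtain G where G: "subspace G" "Domain G = S" "Range G = T"
    "\<And>x y. (x, y) \<in> G \<Longrightarrow> norm x \<le> K * norm y \<and> norm y \<le> K * norm x"
    using assms(1) unfolding biso_def by blast
  obtain H where H: "subspace H" "Domain H = U" "Range H = V"
    "\<And>x y. (x, y) \<in> H \<Longrightarrow> norm x \<le> K * norm y \<and> norm y \<le> K * norm x"
    using assms(2) unfolding biso_def by blast
  define Q where "Q = {((x, u), (y, v)) | x u y v. (x, y) \<in> G \<and> (u, v) \<in> H}"
  have Q [simp]: "((x, u), (y, v)) \<in> Q \<longleftrightarrow> (x, y) \<in> G \<and> (u, v) \<in> H" for x u y v
    by (auto simp: Q_def)
  have "subspace Q"
    unfolding subspace_def
  proof (intro conjI ballI allI)
    show "0 \<in> Q"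
      using subspace_0[OF G(1)] subspace_0[OF H(1)] by (simp add: zero_prod_def)
  next
    fix v w assume "v \<in> Q" "w \<in> Q"
    moreover obtain x u y z x' u' y' z' where "v = ((x, u), (y, z))" "w = ((x', u'), (y', z'))"
      by (metis surj_pair)
    ultimately show "v + w \<in> Q"
      using subspace_add[OF G(1), of "(x, y)" "(x', y')"] subspace_add[OF H(1), of "(u, z)" "(u', z')"]
      by simp
  next
    fix c v assume "v \<in> Q"
    moreover obtain x u y z where "v = ((x, u), (y, z))"
      by (metis surj_pair)
    ultimately show "c *\<^sub>R v \<in> Q"
      using subspace_scale[OF G(1), of "(x, y)" c] subspace_scale[OF H(1), of "(u, z)" c]
      by simp
  qed
  moreover have "Domain Q = S \<times> U" "Range Q = T \<times> V"
    using G(2,3) H(2,3) unfolding Q_def by blast+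
  moreover have "norm v \<le> K * norm w \<and> norm w \<le> K * norm v" if "(v, w) \<in> Q" for v w
    using that G(4) H(4) by (auto simp: Q_def intro!: norm_Pair_le_scale assms(3))
  ultimately show ?thesis by (rule bisoI)
qed

text \<open>One constant serves the whole family. Being an equivalence on families of subspaces that
  respects products, the relation lets the uniform conclusion be reached by calculation, without
  tracking constants.\<close>

definition unif_biso ::
  "'i set \<Rightarrow> ('i \<Rightarrow> 'a::real_normed_vector set) \<Rightarrow> ('i \<Rightarrow> 'b::real_normed_vector set) \<Rightarrow> bool" where
  "unif_biso \<I> S T \<longleftrightarrow> (\<exists>K. \<forall>i\<in>\<I>. biso K (S i) (T i))"

lemma unif_bisoE:
  assumes "unif_biso \<I> S T"
  obtains K where "K \<ge> 1" "\<And>L i. L \<ge> K \<Longrightarrow> i \<in> \<I> \<Longrightarrow> biso L (S i) (T i)"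
proof -
  obtain K where K: "\<forall>i\<in>\<I>. biso K (S i) (T i)" using assms by (auto simp: unif_biso_def)
  show ?thesis
    by (rule that[of "max 1 K"]) (use K in \<open>auto intro: biso_mono\<close>)
qed

lemma unif_biso_sym: "unif_biso \<I> S T \<Longrightarrow> unif_biso \<I> T S"
  unfolding unif_biso_def using biso_sym by blast

lemma unif_biso_trans [trans]:
  assumes "unif_biso \<I> S T" "unif_biso \<I> T U"
  shows "unif_biso \<I> S U"
proof -
  obtain K where K: "K \<ge> 1" "\<And>L i. L \<ge> K \<Longrightarrow> i \<in> \<I> \<Longrightarrow> biso L (S i) (T i)"
    using unif_bisoE[OF assms(1)] by blast
  obtain L where L: "L \<ge> 1" "\<And>M i. M \<ge> L \<Longrightarrow> i \<in> \<I> \<Longrightarrow> biso M (T i) (U i)"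
    using unif_bisoE[OF assms(2)] by blast
  have "biso (K * L) (S i) (U i)" if "i \<in> \<I>" for i
    by (rule biso_trans[OF K(2) L(2)]) (use that K(1) L(1) in auto)
  then show ?thesis by (auto simp: unif_biso_def)
qed

lemma unif_biso_times:
  assumes "unif_biso \<I> S T" "unif_biso \<I> U V"
  shows "unif_biso \<I> (\<lambda>i. S i \<times> U i) (\<lambda>i. T i \<times> V i)"
proof -
  obtain K where K: "K \<ge> 1" "\<And>L i. L \<ge> K \<Longrightarrow> i \<in> \<I> \<Longrightarrow> biso L (S i) (T i)"
    using unif_bisoE[OF assms(1)] by blast
  obtain L where L: "L \<ge> 1" "\<And>M i. M \<ge> L \<Longrightarrow> i \<in> \<I> \<Longrightarrow> biso M (U i) (V i)"
    using unif_bisoE[OF assms(2)] by blast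
  have "biso (max K L) (S i \<times> U i) (T i \<times> V i)" if "i \<in> \<I>" for i
    by (rule biso_times[OF K(2) L(2)]) (use that K(1) in auto)
  then show ?thesis by (auto simp: unif_biso_def)
qed

lemma unif_biso_isometry:
  assumes "linear f" "\<And>x. norm (f x) = norm x" "\<And>i. i \<in> \<I> \<Longrightarrow> subspace (S i)"
    "\<And>i. i \<in> \<I> \<Longrightarrow> f ` S i = T i"
  shows "unif_biso \<I> S T"
  unfolding unif_biso_def
  using biso_linear_image[OF assms(1) assms(3), where K = 1] assms(2,4) by fastforce

lemma unif_biso_refl: "(\<And>i. i \<in> \<I> \<Longrightarrow> subspace (S i)) \<Longrightarrow> unif_biso \<I> S S"
  by (rule unif_biso_isometry[where f = "\<lambda>x. x"]) (auto simp: linear_iff)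

section \<open>Passing between linear homeomorphisms and graphs\<close>

text \<open>Continuity at 0 gives a radius \<open>d\<close> below which \<open>f\<close> has norm
  less than 1; scaling a nonzero \<open>x\<close> to norm \<open>d / 2\<close> yields the constant
  \<open>2 / d\<close>.\<close>

lemma linear_homeomorphism_bound:
  assumes lin: "linear_homeomorphism S T f g" and S: "subspace S"
  shows "\<exists>K. \<forall>x\<in>S. norm (f x) \<le> K * norm x"
proof -
  have scale: "\<And>c x. x \<in> S \<Longrightarrow> f (c *\<^sub>R x) = c *\<^sub>R f x" and cont: "continuous_on S f"
    using lin by (auto simp: linear_homeomorphism_def homeomorphism_def)
  have S0: "0 \<in> S" using S by (rule subspace_0)
  have "f 0 = 0" using scale[OF S0, of 0] by simp
  then obtain d where d: "d > 0" "\<And>x. x \<in> S \<Longrightarrow> norm x < d \<Longrightarrow> norm (f x) < 1"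
    using cont S0 unfolding continuous_on_iff
    by (metis diff_zero dist_norm zero_less_one)
  have "norm (f x) \<le> 2 / d * norm x" if x: "x \<in> S" for x
  proof (cases "x = 0")
    case False
    define c where "c = d / (2 * norm x)"
    have "c > 0" using d(1) False by (simp add: c_def)
    have "norm (c *\<^sub>R x) < d" using d(1) False by (simp add: c_def)
    then have "norm (f (c *\<^sub>R x)) < 1" using d(2) x subspace_scale[OF S] by blast
    then have "c * norm (f x) < 1" using scale[OF x] \<open>c > 0\<close> by simp
    then have "norm (f x) \<le> 1 / c" using \<open>c > 0\<close> by (simp add: field_simps)
    also have "1 / c = 2 / d * norm x" by (simp add: c_def)
    finally show ?thesis .
  qed (simp add: \<open>f 0 = 0\<close>)
  then show ?thesis by blast
qed

lemma linear_homeomorphism_sym: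
  assumes lin: "linear_homeomorphism S T f g" and S: "subspace S"
  shows "linear_homeomorphism T S g f" "subspace T"
proof -
  have add: "\<And>x y. x \<in> S \<Longrightarrow> y \<in> S \<Longrightarrow> f (x + y) = f x + f y"
    and scale: "\<And>c x. x \<in> S \<Longrightarrow> f (c *\<^sub>R x) = c *\<^sub>R f x" and h: "homeomorphism S T f g"
    using lin by (auto simp: linear_homeomorphism_def)
  have gf: "\<And>x. x \<in> S \<Longrightarrow> g (f x) = x" and fg: "\<And>y. y \<in> T \<Longrightarrow> f (g y) = y"
    and im: "f ` S = T" and gT: "\<And>y. y \<in> T \<Longrightarrow> g y \<in> S"
    using h by (auto simp: homeomorphism_def)
  have "g (x + y) = g x + g y" if "x \<in> T" "y \<in> T" for x y
    using add[OF gT gT, OF that] fg that gf subspace_add[OF S] gT by metis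
  moreover have "g (c *\<^sub>R x) = c *\<^sub>R g x" if "x \<in> T" for c x
    using scale[OF gT, OF that] fg that gf subspace_scale[OF S] gT by metis
  ultimately show "linear_homeomorphism T S g f"
    using h by (auto simp: linear_homeomorphism_def intro: homeomorphism_symD)
  have "0 = f 0" using scale[OF subspace_0[OF S], of 0] by simp
  then have "0 \<in> T" using im subspace_0[OF S] by blast
  moreover have "x + y \<in> T" if "x \<in> T" "y \<in> T" for x y
    using that add subspace_add[OF S] im by (metis fg gT imageI)
  moreover have "c *\<^sub>R x \<in> T" if "x \<in> T" for c x
    using that scale subspace_scale[OF S] im by (metis fg gT imageI)
  ultimately show "subspace T" by (simp add: subspace_def)
qed

text \<open>Integer constants make isomorphism a countable union of relations, as the category
  argument requires.\<close>

lemma isomorphic_imp_biso: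
  assumes "isomorphic S T" "subspace S"
  shows "\<exists>n. biso (real n) S T"
proof -
  obtain f g where fg: "linear_homeomorphism S T f g" using assms(1) by (auto simp: isomorphic_def)
  obtain K where K: "\<And>x. x \<in> S \<Longrightarrow> norm (f x) \<le> K * norm x"
    using linear_homeomorphism_bound[OF fg assms(2)] by blast
  obtain L where L: "\<And>y. y \<in> T \<Longrightarrow> norm (g y) \<le> L * norm y"
    using linear_homeomorphism_bound[OF linear_homeomorphism_sym[OF fg assms(2)]] by blast
  have f: "\<And>x y. x \<in> S \<Longrightarrow> y \<in> S \<Longrightarrow> f (x + y) = f x + f y"
    "\<And>c x. x \<in> S \<Longrightarrow> f (c *\<^sub>R x) = c *\<^sub>R f x" "f ` S = T" "\<And>x. x \<in> S \<Longrightarrow> g (f x) = x"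
    using fg by (auto simp: linear_homeomorphism_def homeomorphism_def)
  let ?G = "(\<lambda>x. (x, f x)) ` S"
  have "f 0 = 0" using f(2)[OF subspace_0[OF assms(2)], of 0] by simp
  have "subspace ?G"
    unfolding subspace_def
  proof safe
    show "0 \<in> ?G"
      using subspace_0[OF assms(2)] \<open>f 0 = 0\<close> by (auto simp: zero_prod_def intro!: rev_image_eqI[of 0])
  next
    fix x y assume "x \<in> S" "y \<in> S"
    then show "(x, f x) + (y, f y) \<in> ?G"
      using f(1) subspace_add[OF assms(2)] by (intro rev_image_eqI[of "x + y"]) auto
  next
    fix c x assume "x \<in> S"
    then show "c *\<^sub>R (x, f x) \<in> ?G"
      using f(2) subspace_scale[OF assms(2)] by (intro rev_image_eqI[of "c *\<^sub>R x"]) auto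
  qed
  moreover have "norm x \<le> max K L * norm (f x)" "norm (f x) \<le> max K L * norm x" if "x \<in> S" for x
  proof -
    have "norm x \<le> L * norm (f x)" using L[of "f x"] f(3,4) that by auto
    also have "\<dots> \<le> max K L * norm (f x)" by (simp add: mult_right_mono)
    finally show "norm x \<le> max K L * norm (f x)" .
    have "norm (f x) \<le> K * norm x" using K that by blast
    also have "\<dots> \<le> max K L * norm x" by (simp add: mult_right_mono)
    finally show "norm (f x) \<le> max K L * norm x" .
  qed
  ultimately have "biso (max K L) S T"
    using f(3) by (intro bisoI[of ?G]) auto
  then show ?thesis using biso_mono real_arch_simple by blast
qed

text \<open>Division by zero makes the quotient at \<open>x = 0\<close> equal to 0; this gives
  nonnegativity of the supremum.\<close>

lemma onorm_on_bounds:
  assumes "0 \<in> S" "K \<ge> 0" "\<And>x. x \<in> S \<Longrightarrow> norm (f x) \<le> K * norm x"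
  shows "0 \<le> onorm_on S f" "onorm_on S f \<le> K"
proof -
  have le: "norm (f x) / norm x \<le> K" if "x \<in> S" for x
    using assms(2,3) that by (cases "x = 0") (auto simp: divide_le_eq)
  then have "bdd_above ((\<lambda>x. norm (f x) / norm x) ` S)" by (rule bdd_aboveI2)
  from cSUP_upper[OF assms(1) this] show "0 \<le> onorm_on S f"
    by (simp add: onorm_on_def)
  show "onorm_on S f \<le> K"
    unfolding onorm_on_def using assms(1) le by (intro cSUP_least) auto
qed

text \<open>Applied to differences, the two bounds make \<open>G\<close> single-valued in both
  directions. The resulting maps are linear and \<open>K\<close>-Lipschitz, and the product of their
  norms accounts for \<open>K * K\<close>.\<close>

lemma biso_imp_K_isomorphic:
  assumes "biso K S T" "K \<ge> 0"
  shows "K_isomorphic (K * K) S T"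
proof -
  obtain G where G: "subspace G" "Domain G = S" "Range G = T"
    "\<And>x y. (x, y) \<in> G \<Longrightarrow> norm x \<le> K * norm y \<and> norm y \<le> K * norm x"
    using assms(1) unfolding biso_def by blast
  define f where "f x = (SOME y. (x, y) \<in> G)" for x
  define g where "g y = (SOME x. (x, y) \<in> G)" for y
  have fG: "(x, f x) \<in> G" if "x \<in> S" for x
    unfolding f_def by (rule someI_ex) (use that G(2) in blast)
  have gG: "(g y, y) \<in> G" if "y \<in> T" for y
    unfolding g_def by (rule someI_ex) (use that G(3) in blast)
  have diff: "(x - x', y - y') \<in> G" if "(x, y) \<in> G" "(x', y') \<in> G" for x x' y y'
    using subspace_diff[OF G(1) that] by simp
  have f_eq: "f x = y" if "(x, y) \<in> G" for x y
  proof -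
    have "(x, f x) \<in> G" using that G(2) by (intro fG) blast
    from G(4)[OF diff[OF this that]] show ?thesis by simp
  qed
  have g_eq: "g y = x" if "(x, y) \<in> G" for x y
  proof -
    have "(g y, y) \<in> G" using that G(3) by (intro gG) blast
    from G(4)[OF diff[OF this that]] show ?thesis by simp
  qed
  have lin: "\<forall>x\<in>S. \<forall>y\<in>S. f (x + y) = f x + f y" "\<forall>c. \<forall>x\<in>S. f (c *\<^sub>R x) = c *\<^sub>R f x"
    using subspace_add[OF G(1)] subspace_scale[OF G(1)] fG by (fastforce intro!: f_eq)+
  have lip: "dist (f x) (f x') \<le> K * dist x x'" if "x \<in> S" "x' \<in> S" for x x'
    using G(4)[OF diff[OF fG fG, OF that]] by (simp add: dist_norm)
  have lip': "dist (g x) (g x') \<le> K * dist x x'" if "x \<in> T" "x' \<in> T" for x x'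
    using G(4)[OF diff[OF gG gG, OF that]] by (simp add: dist_norm)
  have "continuous_on S f" "continuous_on T g"
    using lip lip' assms(2) by (auto intro!: lipschitz_on_continuous_on[of K] simp: lipschitz_on_def)
  moreover have "f ` S = T" "g ` T = S"
    using fG gG f_eq g_eq G(2,3) by blast+
  moreover have "\<forall>x\<in>S. g (f x) = x" "\<forall>y\<in>T. f (g y) = y"
    using fG gG f_eq g_eq by blast+
  ultimately have "linear_homeomorphism S T f g"
    using lin by (simp add: linear_homeomorphism_def homeomorphism_def)
  moreover have "onorm_on S f * onorm_on T g \<le> K * K"
  proof -
    have "0 \<in> S" "0 \<in> T" using subspace_0[OF G(1)] G(2,3) by (force simp: zero_prod_def)+
    then show ?thesis
      using fG gG G(4) assms(2) onorm_on_bounds[of S K f] onorm_on_bounds[of T K g]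
      by (intro mult_mono) blast+
  qed
  ultimately show ?thesis unfolding K_isomorphic_def by blast
qed

text \<open>Regrouping factors is isometric for the Euclidean product norm.\<close>

lemma unif_biso_times_assoc:
  assumes "\<And>i. subspace (A i)" "\<And>i. subspace (B i)" "\<And>i. subspace (C i)"
  shows "unif_biso \<I> (\<lambda>i. (A i \<times> B i) \<times> C i) (\<lambda>i. A i \<times> (B i \<times> C i))"
proof (rule unif_biso_isometry)
  let ?f = "\<lambda>w. (fst (fst w), (snd (fst w), snd w))"
  show "linear ?f" by (simp add: linear_iff)
  show "norm (?f w) = norm w" for w
    by (cases w; cases "fst w") (simp add: norm_Pair)
  show "subspace ((A i \<times> B i) \<times> C i)" for i
    by (intro subspace_Times assms)
  show "?f ` ((A i \<times> B i) \<times> C i) = A i \<times> (B i \<times> C i)" for i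
  proof (intro equalityI subsetI)
    fix z assume "z \<in> A i \<times> (B i \<times> C i)"
    then show "z \<in> ?f ` ((A i \<times> B i) \<times> C i)"
      by (intro image_eqI[of _ _ "((fst z, fst (snd z)), snd (snd z))"]) auto
  qed auto
qed

lemma unif_biso_times_right_commute:
  assumes "\<And>i. subspace (A i)" "\<And>i. subspace (B i)" "\<And>i. subspace (C i)"
  shows "unif_biso \<I> (\<lambda>i. (A i \<times> B i) \<times> C i) (\<lambda>i. (A i \<times> C i) \<times> B i)"
proof (rule unif_biso_isometry)
  let ?f = "\<lambda>w. ((fst (fst w), snd w), snd (fst w))"
  show "linear ?f" by (simp add: linear_iff)
  show "norm (?f w) = norm w" for w
    by (cases w; cases "fst w") (simp add: norm_Pair)
  show "subspace ((A i \<times> B i) \<times> C i)" for i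
    by (intro subspace_Times assms)
  show "?f ` ((A i \<times> B i) \<times> C i) = (A i \<times> C i) \<times> B i" for i
  proof (intro equalityI subsetI)
    fix z assume "z \<in> (A i \<times> C i) \<times> B i"
    then show "z \<in> ?f ` ((A i \<times> B i) \<times> C i)"
      by (intro image_eqI[of _ _ "((fst (fst z), snd z), snd (fst z))"]) auto
  qed auto
qed

section \<open>Unconditional decompositions\<close>

lemma subspace_closure:
  fixes S :: "'a::real_normed_vector set"
  assumes "subspace S"
  shows "subspace (closure S)"
  unfolding subspace_def
proof (intro conjI ballI allI)
  show "0 \<in> closure S"
    using subspace_0[OF assms] closure_subset by blast
next
  fix x y assume "x \<in> closure S" "y \<in> closure S"
  then obtain f g where f: "\<And>n. f n \<in> S" "f \<longlonglongrightarrow> x" and g: "\<And>n. g n \<in> S" "g \<longlonglongrightarrow> y"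
    unfolding closure_sequential by blast
  then have "(\<lambda>n. f n + g n) \<longlonglongrightarrow> x + y" "\<And>n. f n + g n \<in> S"
    using subspace_add[OF assms] by (simp_all add: tendsto_add)
  then show "x + y \<in> closure S"
    unfolding closure_sequential by (intro exI[of _ "\<lambda>n. f n + g n"]) simp
next
  fix c x assume "x \<in> closure S"
  then obtain f where f: "\<And>n. f n \<in> S" "f \<longlonglongrightarrow> x"
    unfolding closure_sequential by blast
  then have "(\<lambda>n. c *\<^sub>R f n) \<longlonglongrightarrow> c *\<^sub>R x" "\<And>n. c *\<^sub>R f n \<in> S"
    using subspace_scale[OF assms] by (simp_all add: tendsto_scaleR)
  then show "c *\<^sub>R x \<in> closure S"
    unfolding closure_sequential by (intro exI[of _ "\<lambda>n. c *\<^sub>R f n"]) simp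
qed

text \<open>The bounds in \<open>graph_code\<close> are stated for sums over initial segments; this
  form of the span shows that they reach every element of it.\<close>

lemma span_range_explicit:
  fixes w :: "nat \<Rightarrow> 'a::real_vector"
  assumes "v \<in> span (range w)"
  shows "\<exists>n c. v = (\<Sum>k<n. c k *\<^sub>R w k)"
  using assms
proof (induction rule: span_induct_alt)
  case base
  show ?case by (intro exI[of _ 0]) simp
next
  case (step a x y)
  then obtain j n c where x: "x = w j" and y: "y = (\<Sum>k<n. c k *\<^sub>R w k)" by blast
  define N where "N = max n (Suc j)"
  have "j < N" by (simp add: N_def)
  define c' where "c' k = (if k = j then a else 0) + (if k < n then c k else 0)" for k
  have "(\<Sum>k<N. c' k *\<^sub>R w k) =
      (\<Sum>k<N. if k = j then a *\<^sub>R w k else 0) + (\<Sum>k<N. if k < n then c k *\<^sub>R w k else 0)"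
    unfolding sum.distrib[symmetric] by (rule sum.cong) (auto simp: c'_def scaleR_add_left)
  also have "(\<Sum>k<N. if k = j then a *\<^sub>R w k else 0) = a *\<^sub>R x"
    using \<open>j < N\<close> by (simp add: x)
  also have "(\<Sum>k<N. if k < n then c k *\<^sub>R w k else 0) = y"
    unfolding y by (rule sum.mono_neutral_cong_right) (auto simp: N_def)
  finally show ?case by (metis x)
qed

section \<open>Projections onto partial sums\<close>

locale unconditional =
  fixes E :: "nat \<Rightarrow> 'a::banach set"
  assumes unconditional: "unconditional_decomposition E"
begin

abbreviation X :: "nat set \<Rightarrow> 'a set" where
  "X \<equiv> partial_sum_space E"

definition proj :: "nat set \<Rightarrow> 'a \<Rightarrow> 'a" where
  "proj I x = (\<Sum>n. if n \<in> I then component E x n else 0)"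

lemma subspace_E: "subspace (E n)"
  using unconditional by (simp add: unconditional_decomposition_def schauder_decomposition_def)

lemma ex1_component: "\<exists>!u. (\<forall>n. u n \<in> E n) \<and> u sums x"
  using unconditional by (simp add: unconditional_decomposition_def schauder_decomposition_def)

lemma component_mem: "component E x n \<in> E n" and component_sums: "component E x sums x"
  using theI'[OF ex1_component, of x] by (simp_all add: component_def)

lemma component_eqI: "(\<And>n. u n \<in> E n) \<Longrightarrow> u sums x \<Longrightarrow> component E x = u"
  using ex1_component[of x] component_mem[of x] component_sums[of x] by blast

lemma component_add: "component E (x + y) n = component E x n + component E y n"
proof -
  have "component E (x + y) = (\<lambda>n. component E x n + component E y n)"
    by (intro component_eqI subspace_add[OF subspace_E] component_mem sums_add component_sums)
  then show ?thesis by simp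
qed

lemma component_scaleR: "component E (c *\<^sub>R x) n = c *\<^sub>R component E x n"
proof -
  have "component E (c *\<^sub>R x) = (\<lambda>n. c *\<^sub>R component E x n)"
    by (intro component_eqI subspace_scale[OF subspace_E] component_mem sums_scaleR_right component_sums)
  then show ?thesis by simp
qed

lemma proj_sums: "(\<lambda>n. if n \<in> I then component E x n else 0) sums proj I x"
  unfolding proj_def using unconditional
  by (auto simp: unconditional_decomposition_def intro: summable_sums)

lemma component_proj: "component E (proj I x) n = (if n \<in> I then component E x n else 0)"
proof -
  have "component E (proj I x) = (\<lambda>n. if n \<in> I then component E x n else 0)"
    by (rule component_eqI[OF _ proj_sums]) (simp add: component_mem subspace_0[OF subspace_E])
  then show ?thesis by simp
qed

lemma component_inject: "(\<And>n. component E x n = component E y n) \<Longrightarrow> x = y"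
  using component_sums[of x] component_sums[of y] sums_unique2 by (metis ext)

lemma linear_proj: "linear (proj I)"
  by (rule linearI; rule component_inject) (simp_all add: component_proj component_add component_scaleR)

lemma proj_proj: "proj I (proj J x) = proj (I \<inter> J) x"
  by (rule component_inject) (simp add: component_proj)

lemma proj_union: "I \<inter> J = {} \<Longrightarrow> proj (I \<union> J) x = proj I x + proj J x"
  by (rule component_inject) (auto simp: component_proj component_add)

lemma proj_mem: "proj I x \<in> X I"
  by (simp add: partial_sum_space_def component_proj)

lemma proj_id_iff: "proj I x = x \<longleftrightarrow> x \<in> X I"
proof
  assume "x \<in> X I"
  then show "proj I x = x"
    by - (rule component_inject, simp add: component_proj partial_sum_space_def)
qed (metis proj_mem)

lemma proj_id: "x \<in> X I \<Longrightarrow> proj I x = x"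
  by (simp add: proj_id_iff)

lemma range_proj: "range (proj I) = X I"
proof (intro equalityI subsetI)
  show "x \<in> range (proj I)" if "x \<in> X I" for x
    using proj_id[OF that] rangeI by metis
qed (auto simp: proj_mem)

lemma subspace_X: "subspace (X I)"
  using linear_subspace_image[OF linear_proj subspace_UNIV] by (simp add: range_proj)

lemma X_UNIV: "X UNIV = UNIV"
  by (simp add: partial_sum_space_def)

lemma proj_bound: "\<exists>C\<ge>1. \<forall>I x. norm (proj I x) \<le> C * norm x"
proof -
  obtain C where C: "\<And>x I. norm (proj I x) \<le> C * norm x"
    using unconditional by (auto simp: unconditional_decomposition_def proj_def)
  have "norm (proj I x) \<le> max 1 C * norm x" for I x
    using C[of I x] mult_right_mono[of C "max 1 C" "norm x"] by simp
  then show ?thesis by (intro exI[of _ "max 1 C"]) simp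
qed

lemma proj_tail_tendsto_0: "(\<lambda>N. proj {N..} x) \<longlonglongrightarrow> 0"
proof -
  have "proj {N..} x = x - (\<Sum>n<N. component E x n)" for N
  proof -
    have "(\<lambda>n. if n \<in> {..<N} then component E x n else 0) sums (\<Sum>n<N. component E x n)"
      by (rule sums_If_finite_set) simp
    then have "proj {..<N} x = (\<Sum>n<N. component E x n)"
      using proj_sums sums_unique2 by blast
    moreover have "proj ({..<N} \<union> {N..}) x = x"
    proof (rule proj_id)
      have "{..<N} \<union> {N..} = UNIV" by auto
      then show "x \<in> X ({..<N} \<union> {N..})" by (simp add: X_UNIV)
    qed
    moreover have "proj ({..<N} \<union> {N..}) x = proj {..<N} x + proj {N..} x"
      by (rule proj_union) auto
    ultimately show ?thesis by (simp add: algebra_simps)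
  qed
  moreover have "(\<lambda>N. x - (\<Sum>n<N. component E x n)) \<longlonglongrightarrow> x - x"
    using component_sums[of x] by (intro tendsto_diff tendsto_const) (simp add: sums_def)
  ultimately show ?thesis by simp
qed

text \<open>Joint continuity in the index set and the vector. Index sets that agree below
  \<open>N\<close> give projections of \<open>x\<close> differing only on the tail of
  \<open>x\<close>, which is small, and the bound \<open>C\<close> common to all projections
  controls both the tail and \<open>f j - x\<close>.\<close>

lemma proj_tendsto:
  assumes "\<And>n. eventually (\<lambda>j. n \<in> I j \<longleftrightarrow> n \<in> J) sequentially" "f \<longlonglongrightarrow> x"
  shows "(\<lambda>j. proj (I j) (f j)) \<longlonglongrightarrow> proj J x"
proof -
  obtain C where C: "C \<ge> 1" "\<And>I x. norm (proj I x) \<le> C * norm x" using proj_bound by blast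
  have "(\<lambda>j. proj (I j) x) \<longlonglongrightarrow> proj J x"
    unfolding tendsto_iff
  proof (intro allI impI)
    fix e :: real assume "e > 0"
    then have "e / (2 * C) > 0" using C(1) by simp
    then obtain N where N: "norm (proj {N..} x) < e / (2 * C)"
      using proj_tail_tendsto_0[of x] unfolding LIMSEQ_iff by fastforce
    have "eventually (\<lambda>j. \<forall>n\<in>{..<N}. n \<in> I j \<longleftrightarrow> n \<in> J) sequentially"
      by (rule eventually_ball_finite) (use assms(1) in auto)
    then show "eventually (\<lambda>j. dist (proj (I j) x) (proj J x) < e) sequentially"
    proof eventually_elim
      case (elim j)
      have split: "proj A x = proj (A \<inter> {..<N}) x + proj A (proj {N..} x)" for A
      proof -
        have "A = (A \<inter> {..<N}) \<union> (A \<inter> {N..})" by auto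
        then have "proj A x = proj ((A \<inter> {..<N}) \<union> (A \<inter> {N..})) x" by simp
        also have "\<dots> = proj (A \<inter> {..<N}) x + proj (A \<inter> {N..}) x" by (rule proj_union) auto
        finally show ?thesis by (simp add: proj_proj)
      qed
      have "I j \<inter> {..<N} = J \<inter> {..<N}" using elim by auto
      then have "dist (proj (I j) x) (proj J x)
          = norm (proj (I j) (proj {N..} x) - proj J (proj {N..} x))"
        using split[of "I j"] split[of J] by (simp add: dist_norm)
      also have "\<dots> \<le> C * norm (proj {N..} x) + C * norm (proj {N..} x)"
        by (intro order_trans[OF norm_triangle_ineq4] add_mono C(2))
      also have "\<dots> < e" using N C(1) by (simp add: field_simps)
      finally show ?case .
    qed
  qed
  moreover have "(\<lambda>j. proj (I j) (f j - x)) \<longlonglongrightarrow> 0"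
  proof (rule Lim_null_comparison)
    show "(\<lambda>j. C * norm (f j - x)) \<longlonglongrightarrow> 0"
      using assms(2) by (intro tendsto_mult_right_zero tendsto_norm_zero) (simp add: LIM_zero_iff)
    show "eventually (\<lambda>j. norm (proj (I j) (f j - x)) \<le> C * norm (f j - x)) sequentially"
      using C(2) by simp
  qed
  ultimately have "(\<lambda>j. proj (I j) x + proj (I j) (f j - x)) \<longlonglongrightarrow> proj J x + 0"
    by (rule tendsto_add)
  then show ?thesis
    by (simp add: linear_add[OF linear_proj, symmetric])
qed

text \<open>The map sends \<open>x\<close> to its two projections. The common bound \<open>C\<close>
  yields the constant \<open>2 * C\<close> for all pairs at once.\<close>

lemma biso_disjoint_union: "\<exists>K. \<forall>I J. I \<inter> J = {} \<longrightarrow> biso K (X (I \<union> J)) (X I \<times> X J)"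
proof -
  obtain C where C: "C \<ge> 1" "\<And>I x. norm (proj I x) \<le> C * norm x" using proj_bound by blast
  have "biso (2 * C) (X (I \<union> J)) (X I \<times> X J)" if disj: "I \<inter> J = {}" for I J
  proof -
    let ?f = "\<lambda>x. (proj I x, proj J x)"
    have "linear ?f"
      using linear_proj by (simp add: linear_iff)
    then have "biso (2 * C) (X (I \<union> J)) (?f ` X (I \<union> J))"
    proof (rule biso_linear_image[OF _ subspace_X])
      fix x assume "x \<in> X (I \<union> J)"
      then have "x = proj (I \<union> J) x" by (rule proj_id[symmetric])
      also have "\<dots> = proj I x + proj J x" by (rule proj_union[OF disj])
      finally have x: "x = proj I x + proj J x" .
      have "norm x \<le> norm (proj I x) + norm (proj J x)"
        by (subst x) (rule norm_triangle_ineq)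
      also have "\<dots> \<le> 2 * norm (?f x)"
        using norm_fst_le[of "proj I x" "proj J x"] norm_snd_le[of "proj J x" "proj I x"] by simp
      also have "\<dots> \<le> (2 * C) * norm (?f x)"
        using C(1) by (intro mult_right_mono) auto
      finally have 1: "norm x \<le> (2 * C) * norm (?f x)" .
      have "norm (?f x) \<le> norm (proj I x) + norm (proj J x)"
        by (rule norm_Pair_le)
      also have "\<dots> \<le> C * norm x + C * norm x" by (intro add_mono C(2))
      finally show "norm x \<le> (2 * C) * norm (?f x) \<and> norm (?f x) \<le> (2 * C) * norm x"
        using 1 by simp
    qed
    moreover have "?f ` X (I \<union> J) = X I \<times> X J"
    proof (intro equalityI subsetI)
      fix z assume "z \<in> X I \<times> X J"
      then obtain u v where z: "z = (u, v)" "u \<in> X I" "v \<in> X J" by blast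
      have comp: "component E u n = 0" if "n \<notin> I" for n
        using z(2) that by (simp add: partial_sum_space_def)
      have comp': "component E v n = 0" if "n \<notin> J" for n
        using z(3) that by (simp add: partial_sum_space_def)
      have "proj I (u + v) = u" "proj J (u + v) = v"
        using disj comp comp' IntI[of _ I J]
        by - (rule component_inject, auto simp: component_proj component_add)+
      moreover have "u + v \<in> X (I \<union> J)"
        using comp comp' by (simp add: partial_sum_space_def component_add)
      ultimately show "z \<in> ?f ` X (I \<union> J)" unfolding z(1) by (intro rev_image_eqI[of "u + v"]) simp_all
    qed (auto simp: proj_mem)
    ultimately show ?thesis by simp
  qed
  then show ?thesis by blast
qed

section \<open>Closed coding of isomorphisms between partial sums\<close>

text \<open>A closed condition on \<open>(I, J, w)\<close>, by which the sequence \<open>w\<close> spans a dense subspace of the graph of a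
  \<open>K\<close>-isomorphism. Surjectivity is encoded by listing the points of the graph above \<^term>\<open>proj I (d k)\<close>
  at even indices and those above \<^term>\<open>proj J (d k)\<close> at odd ones.\<close>

definition graph_code :: "(nat \<Rightarrow> 'a) \<Rightarrow> real \<Rightarrow> nat set \<Rightarrow> nat set \<Rightarrow> (nat \<Rightarrow> 'a \<times> 'a) \<Rightarrow> bool" where
  "graph_code d K I J w \<longleftrightarrow>
    (\<forall>k. fst (w (2 * k)) = proj I (d k) \<and> snd (w (2 * k + 1)) = proj J (d k) \<and>
      proj I (fst (w k)) = fst (w k) \<and> proj J (snd (w k)) = snd (w k)) \<and>
    (\<forall>n c. norm (fst (\<Sum>k<n. c k *\<^sub>R w k)) \<le> K * norm (snd (\<Sum>k<n. c k *\<^sub>R w k)) \<and>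
      norm (snd (\<Sum>k<n. c k *\<^sub>R w k)) \<le> K * norm (fst (\<Sum>k<n. c k *\<^sub>R w k)))"

text \<open>Each clause is an equation or a weak inequality that involves finitely many entries of
  \<open>w\<close> and projections, so \<open>proj_tendsto\<close> carries it to the limit.\<close>

lemma graph_code_tendsto:
  assumes code: "\<And>j. graph_code d K (I' j) (J' j) (w' j)"
    and I: "\<And>n. eventually (\<lambda>j. n \<in> I' j \<longleftrightarrow> n \<in> I) sequentially"
    and J: "\<And>n. eventually (\<lambda>j. n \<in> J' j \<longleftrightarrow> n \<in> J) sequentially"
    and w: "\<And>k. (\<lambda>j. w' j k) \<longlonglongrightarrow> w k"
  shows "graph_code d K I J w"
proof -
  have fst: "(\<lambda>j. fst (w' j k)) \<longlonglongrightarrow> fst (w k)" and snd: "(\<lambda>j. snd (w' j k)) \<longlonglongrightarrow> snd (w k)" for k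
    by (intro tendsto_intros w)+
  have code': "fst (w' j (2 * k)) = proj (I' j) (d k)" "snd (w' j (2 * k + 1)) = proj (J' j) (d k)"
    "proj (I' j) (fst (w' j k)) = fst (w' j k)" "proj (J' j) (snd (w' j k)) = snd (w' j k)"
    "norm (fst (\<Sum>k<n. c k *\<^sub>R w' j k)) \<le> K * norm (snd (\<Sum>k<n. c k *\<^sub>R w' j k))"
    "norm (snd (\<Sum>k<n. c k *\<^sub>R w' j k)) \<le> K * norm (fst (\<Sum>k<n. c k *\<^sub>R w' j k))" for j k n c
    using code[of j] by (simp_all add: graph_code_def)
  show ?thesis
    unfolding graph_code_def
  proof (intro conjI allI)
    fix k
    show "fst (w (2 * k)) = proj I (d k)"
      using fst[of "2 * k"] proj_tendsto[OF I tendsto_const, of "d k"] LIMSEQ_unique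
      unfolding code' by blast
    show "snd (w (2 * k + 1)) = proj J (d k)"
      using snd[of "2 * k + 1"] proj_tendsto[OF J tendsto_const, of "d k"] LIMSEQ_unique
      unfolding code' by blast
    show "proj I (fst (w k)) = fst (w k)"
      using fst[of k] proj_tendsto[OF I fst, of k] LIMSEQ_unique
      unfolding code' by blast
    show "proj J (snd (w k)) = snd (w k)"
      using snd[of k] proj_tendsto[OF J snd, of k] LIMSEQ_unique
      unfolding code' by blast
  next
    fix n c
    have lim: "(\<lambda>j. \<Sum>k<n. c k *\<^sub>R w' j k) \<longlonglongrightarrow> (\<Sum>k<n. c k *\<^sub>R w k)"
      by (intro tendsto_intros w)
    show "norm (fst (\<Sum>k<n. c k *\<^sub>R w k)) \<le> K * norm (snd (\<Sum>k<n. c k *\<^sub>R w k))"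
      by (rule LIMSEQ_le[OF tendsto_norm[OF tendsto_fst[OF lim]]
            tendsto_mult[OF tendsto_const tendsto_norm[OF tendsto_snd[OF lim]]]]) (simp add: code')
    show "norm (snd (\<Sum>k<n. c k *\<^sub>R w k)) \<le> K * norm (fst (\<Sum>k<n. c k *\<^sub>R w k))"
      by (rule LIMSEQ_le[OF tendsto_norm[OF tendsto_snd[OF lim]]
            tendsto_mult[OF tendsto_const tendsto_norm[OF tendsto_fst[OF lim]]]]) (simp add: code')
  qed
qed

lemma biso_imp_graph_code:
  assumes "biso K (X I) (X J)"
  shows "\<exists>w. graph_code d K I J w"
proof -
  obtain G where G: "subspace G" "Domain G = X I" "Range G = X J"
    "\<And>x y. (x, y) \<in> G \<Longrightarrow> norm x \<le> K * norm y \<and> norm y \<le> K * norm x"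
    using assms unfolding biso_def by blast
  have "\<exists>y. (proj I x, y) \<in> G" "\<exists>z. (z, proj J x) \<in> G" for x
    using G(2,3) proj_mem by blast+
  then obtain y z where y: "\<And>x. (proj I x, y x) \<in> G" and z: "\<And>x. (z x, proj J x) \<in> G"
    by metis
  define w where "w k = (if even k then (proj I (d (k div 2)), y (d (k div 2)))
    else (z (d (k div 2)), proj J (d (k div 2))))" for k
  have wG: "w k \<in> G" for k by (simp add: w_def y z)
  have "fst (w k) \<in> X I" "snd (w k) \<in> X J" for k
    using wG[of k] G(2,3) by (metis DomainI RangeI prod.collapse)+
  moreover have "norm (fst (\<Sum>k<n. c k *\<^sub>R w k)) \<le> K * norm (snd (\<Sum>k<n. c k *\<^sub>R w k)) \<and>
      norm (snd (\<Sum>k<n. c k *\<^sub>R w k)) \<le> K * norm (fst (\<Sum>k<n. c k *\<^sub>R w k))" for n c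
  proof (rule G(4))
    show "(fst (\<Sum>k<n. c k *\<^sub>R w k), snd (\<Sum>k<n. c k *\<^sub>R w k)) \<in> G"
      unfolding prod.collapse by (intro subspace_sum[OF G(1)] subspace_scale[OF G(1)] wG)
  qed
  ultimately have "graph_code d K I J w"
    unfolding graph_code_def by (simp add: proj_id) (simp add: w_def)
  then show ?thesis by (rule exI[of _ w])
qed

text \<open>The two-sided bound extends to the closed span \<open>G\<close> and makes both
  coordinate maps bounded below on it. Their images are therefore complete, hence closed, and they
  contain the projections of a dense sequence, so they are all of \<open>X I\<close> and
  \<open>X J\<close>.\<close>

lemma graph_code_imp_biso:
  assumes code: "graph_code d K I J w" and dense: "closure (range d) = UNIV" and K: "K \<ge> 0"
  shows "biso K (X I) (X J)"
proof -
  obtain C where C: "C \<ge> 1" "\<And>I x. norm (proj I x) \<le> C * norm x" using proj_bound by blast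
  have bl: "bounded_linear (proj A)" for A
    using linear_proj C(2) by (intro bounded_linear_intro[of _ C]) (auto simp: linear_iff mult.commute)
  have closed_X: "closed (X A)" for A
  proof -
    have "X A = {x. proj A x = x}" by (auto simp: proj_id_iff)
    moreover have "closed {x. proj A x = x}"
      by (intro closed_Collect_eq linear_continuous_on bl continuous_on_id)
    ultimately show ?thesis by simp
  qed
  define G where "G = closure (span (range w))"
  have G: "subspace G" "closed G"
    by (simp_all add: G_def subspace_closure)
  have wG: "w k \<in> G" for k
    unfolding G_def by (rule subsetD[OF closure_subset], rule span_base) simp
  have "w k \<in> X I \<times> X J" for k
    using code by (simp add: graph_code_def proj_id_iff mem_Times_iff)
  then have "span (range w) \<subseteq> X I \<times> X J"
    by (intro span_minimal subspace_Times subspace_X) blast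
  then have GX: "G \<subseteq> X I \<times> X J"
    unfolding G_def by (intro closure_minimal closed_Times closed_X)
  have "span (range w) \<subseteq> {v. norm (fst v) \<le> K * norm (snd v) \<and> norm (snd v) \<le> K * norm (fst v)}"
  proof
    fix v assume "v \<in> span (range w)"
    then obtain n c where "v = (\<Sum>k<n. c k *\<^sub>R w k)" using span_range_explicit by blast
    then show "v \<in> {v. norm (fst v) \<le> K * norm (snd v) \<and> norm (snd v) \<le> K * norm (fst v)}"
      using code by (simp add: graph_code_def)
  qed
  then have "G \<subseteq> {v. norm (fst v) \<le> K * norm (snd v) \<and> norm (snd v) \<le> K * norm (fst v)}"
    unfolding G_def
    by (intro closure_minimal closed_Collect_conj closed_Collect_le continuous_intros)
  then have bound: "norm (fst v) \<le> K * norm (snd v)" "norm (snd v) \<le> K * norm (fst v)"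
    if "v \<in> G" for v
    using that by auto
  \<comment> \<open>On \<open>G\<close>, \<open>norm v\<close> is at most
    \<open>norm (fst v) + norm (snd v)\<close>, hence at most \<open>1 + K\<close> times the norm of
    either coordinate.\<close>
  have pos: "0 < 1 / (1 + K)" using K by simp
  have norm_le: "norm v \<le> norm (fst v) + norm (snd v)" for v :: "'a \<times> 'a"
    using norm_Pair_le[of "fst v" "snd v"] by simp
  have "complete G" using G(2) by (simp add: complete_eq_closed)
  have "1 / (1 + K) * norm v \<le> norm (fst v)" if "v \<in> G" for v
    using bound[OF that] norm_le[of v] K by (simp add: field_simps)
  then have "complete (fst ` G)"
    using complete_isometric_image[OF pos G(1) bounded_linear_fst] \<open>complete G\<close> by blast
  have "1 / (1 + K) * norm v \<le> norm (snd v)" if "v \<in> G" for v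
    using bound[OF that] norm_le[of v] K by (simp add: field_simps)
  then have "complete (snd ` G)"
    using complete_isometric_image[OF pos G(1) bounded_linear_snd] \<open>complete G\<close> by blast
  have X_le: "X A \<subseteq> S" if S: "complete S" "\<And>k. proj A (d k) \<in> S" for A S
  proof -
    have "X A = proj A ` closure (range d)" by (simp add: dense range_proj)
    also have "\<dots> \<subseteq> closure (proj A ` range d)"
      by (rule closure_bounded_linear_image_subset[OF bl])
    also have "\<dots> \<subseteq> S"
      using S by (intro closure_minimal) (auto simp: complete_imp_closed)
    finally show ?thesis .
  qed
  have "proj I (d k) \<in> fst ` G" "proj J (d k) \<in> snd ` G" for k
  proof -
    have "proj I (d k) = fst (w (2 * k))" "proj J (d k) = snd (w (2 * k + 1))"
      using code unfolding graph_code_def by simp_all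
    then show "proj I (d k) \<in> fst ` G" "proj J (d k) \<in> snd ` G"
      using wG by blast+
  qed
  then have "X I \<subseteq> fst ` G" "X J \<subseteq> snd ` G"
    by (intro X_le \<open>complete (fst ` G)\<close> \<open>complete (snd ` G)\<close>; simp)+
  then have "Domain G = X I" "Range G = X J"
    using GX unfolding Domain_fst Range_snd by auto
  then show ?thesis
    using G(1) bound by (intro bisoI[of G]) auto
qed

section \<open>Category applied to partial sums\<close>

text \<open>The truth values \<open>p\<close> and \<open>q\<close> select a set or its complement in
  each coordinate. If all these countably many relations were meager, a perfect set avoiding their
  union would witness perfectness.\<close>

lemma nonmeager_biso:
  assumes "\<not> perfect_decomposition E"
  shows "\<exists>p q n. \<not> meager {\<gamma> :: nat \<Rightarrow> bool \<times> bool. biso (real n) (X {i. fst (\<gamma> i) = p}) (X {i. snd (\<gamma> i) = q})}"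
proof (rule ccontr)
  let ?A = "\<lambda>p q n. {\<gamma> :: nat \<Rightarrow> bool \<times> bool. biso (real n) (X {i. fst (\<gamma> i) = p}) (X {i. snd (\<gamma> i) = q})}"
  let ?S = "\<Union>(p, q, n)\<in>UNIV. ?A p q n"
  assume "\<not> ?thesis"
  then have "meager (?A p q n)" for p q n by blast
  then have "meager ?S" by (intro meager_UN) auto
  from meager_imp_perfect_square[OF this]
  obtain \<Phi> :: "(nat \<Rightarrow> bool) \<Rightarrow> nat \<Rightarrow> bool"
    where \<Phi>: "\<forall>x y. x \<noteq> y \<longrightarrow> (\<lambda>i. (\<Phi> x i, \<Phi> y i)) \<notin> ?S"
    and local: "\<forall>i. \<exists>m. \<forall>x y. (\<forall>j<m. x j = y j) \<longrightarrow> \<Phi> x i = \<Phi> y i"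
    by (elim exE conjE) (rule that)
  have not_iso: "\<not> isomorphic (X {i. \<Phi> x i = p}) (X {i. \<Phi> y i = q})" if "x \<noteq> y" for x y p q
  proof
    assume "isomorphic (X {i. \<Phi> x i = p}) (X {i. \<Phi> y i = q})"
    then obtain n where "biso (real n) (X {i. \<Phi> x i = p}) (X {i. \<Phi> y i = q})"
      using isomorphic_imp_biso[OF _ subspace_X] by blast
    then have "(\<lambda>i. (\<Phi> x i, \<Phi> y i)) \<in> ?A p q n" by simp
    then have "(\<lambda>i. (\<Phi> x i, \<Phi> y i)) \<in> ?S" by blast
    then show False using \<Phi> that by blast
  qed
  \<comment> \<open>Isomorphism is reflexive, so distinct points with the same image would
    contradict \<open>not_iso\<close>.\<close>
  have "inj \<Phi>"
  proof (rule injI, rule ccontr)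
    fix x y assume eq: "\<Phi> x = \<Phi> y" and "x \<noteq> y"
    have "isomorphic (X {i. \<Phi> x i = True}) (X {i. \<Phi> x i = True})"
      unfolding isomorphic_def linear_homeomorphism_def
      by (intro exI[of _ "\<lambda>x. x"]) (simp add: homeomorphism_ident)
    then show False using not_iso[OF \<open>x \<noteq> y\<close>, of True True] eq by simp
  qed
  then have "perfect_set (range \<Phi>)" by (rule perfect_range) (rule local[THEN spec])
  moreover have "\<not> isomorphic (X {i. \<alpha> i}) (X {i. \<beta> i}) \<and> \<not> isomorphic (X {i. \<not> \<alpha> i}) (X {i. \<beta> i}) \<and>
      \<not> isomorphic (X {i. \<not> \<alpha> i}) (X {i. \<not> \<beta> i})"
    if ran: "\<alpha> \<in> range \<Phi>" "\<beta> \<in> range \<Phi>" and "\<alpha> \<noteq> \<beta>" for \<alpha> \<beta>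
  proof -
    obtain x y where "\<alpha> = \<Phi> x" "\<beta> = \<Phi> y" using ran by blast
    moreover have "x \<noteq> y" using calculation \<open>\<alpha> \<noteq> \<beta>\<close> by blast
    ultimately show ?thesis
      using not_iso[of x y True True] not_iso[of x y False True] not_iso[of x y False False] by simp
  qed
  ultimately have "perfect_decomposition E"
    unfolding perfect_decomposition_def by (intro exI[of _ "range \<Phi>"]) blast
  then show False using assms by blast
qed

text \<open>\<open>J\<close> and \<open>c\<close> are read off the two coordinates of one pattern of
  pairs. Keeping the first coordinate equal to the pattern everywhere leaves conditions on
  \<open>T\<close> alone, and the constant is that of the non-meager relation.\<close>

lemma generic_subspace:
  assumes separable: "\<exists>D :: 'a set. countable D \<and> closure D = UNIV"
    and not_perfect: "\<not> perfect_decomposition E"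
  shows "\<exists>J c K k. strict_mono k \<and> (\<forall>T. T \<inter> {..<k 0} = c \<inter> {..<k 0} \<longrightarrow>
      (\<exists>\<^sub>\<infinity>n. T \<inter> {k n..<k (Suc n)} = c \<inter> {k n..<k (Suc n)}) \<longrightarrow> biso K (X J) (X T))"
proof -
  obtain D :: "'a set" where D: "countable D" "closure D = UNIV" using separable by blast
  then have "D \<noteq> {}" by auto
  then have d: "closure (range (from_nat_into D)) = UNIV"
    using D by (simp add: range_from_nat_into)
  obtain p q N where nonmeager:
    "\<not> meager {\<gamma> :: nat \<Rightarrow> bool \<times> bool. biso (real N) (X {i. fst (\<gamma> i) = p}) (X {i. snd (\<gamma> i) = q})}"
    using nonmeager_biso[OF not_perfect] by blast
  define R where
    "R \<gamma> = graph_code (from_nat_into D) (real N) {i. fst (\<gamma> i) = p} {i. snd (\<gamma> i) = q}"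
    for \<gamma> :: "nat \<Rightarrow> bool \<times> bool"
  have R_iff: "(\<exists>w. R \<gamma> w) \<longleftrightarrow> biso (real N) (X {i. fst (\<gamma> i) = p}) (X {i. snd (\<gamma> i) = q})" for \<gamma>
    unfolding R_def using graph_code_imp_biso[OF _ d] biso_imp_graph_code by (meson of_nat_0_le_iff)
  have closed: "R \<gamma> w" if "\<And>j. R (\<gamma>s j) (ws j)"
    "\<And>i. eventually (\<lambda>j. \<gamma>s j i = \<gamma> i) sequentially" "\<And>k. (\<lambda>j. ws j k) \<longlonglongrightarrow> w k" for \<gamma>s \<gamma> ws w
    unfolding R_def
  proof (rule graph_code_tendsto[OF that(1)[unfolded R_def] _ _ that(3)])
    fix i
    show "eventually (\<lambda>j. i \<in> {i. fst (\<gamma>s j i) = p} \<longleftrightarrow> i \<in> {i. fst (\<gamma> i) = p}) sequentially"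
      using that(2)[of i] by eventually_elim simp
    show "eventually (\<lambda>j. i \<in> {i. snd (\<gamma>s j i) = q} \<longleftrightarrow> i \<in> {i. snd (\<gamma> i) = q}) sequentially"
      using that(2)[of i] by eventually_elim simp
  qed
  have "\<exists>s. meager (cyl s - {\<gamma>. \<exists>w. R \<gamma> w})"
  proof (rule analytic_comeager_in_cyl)
    show "countable (D \<times> D)" using D(1) by simp
    show "closure (D \<times> D) = (UNIV :: ('a \<times> 'a) set)" using D(2) by (simp add: closure_Times)
    show "\<not> meager {\<gamma>. \<exists>w. R \<gamma> w}" using nonmeager by (simp add: R_iff)
  qed (rule closed)
  then obtain s where s: "meager (cyl s - {\<gamma>. \<exists>w. R \<gamma> w})" by blast
  obtain k g where k: "strict_mono k" "k 0 = length s"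
    and g: "\<And>\<gamma>. \<exists>\<^sub>\<infinity>n. \<forall>i\<in>{k n..<k (Suc n)}. \<gamma> i = g i \<Longrightarrow> \<gamma> \<notin> cyl s - {\<gamma>. \<exists>w. R \<gamma> w}"
    using meager_blocks[OF s, of "length s"] by blast
  \<comment> \<open>The stem \<open>s\<close> followed by the block pattern; the blocks begin
    exactly where the stem ends.\<close>
  define h where "h i = (if i < length s then s ! i else g i)" for i
  have h: "h i = g i" if "i \<in> {k n..<k (Suc n)}" for i n
  proof -
    have "k 0 \<le> k n" using k(1) by (simp add: strict_mono_less_eq)
    then show ?thesis using that k(2) by (simp add: h_def)
  qed
  have "biso (real N) (X {i. fst (h i) = p}) (X T)"
    if init: "T \<inter> {..<k 0} = {i. snd (h i) = q} \<inter> {..<k 0}"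
      and blocks: "\<exists>\<^sub>\<infinity>n. T \<inter> {k n..<k (Suc n)} = {i. snd (h i) = q} \<inter> {k n..<k (Suc n)}" for T
  proof -
    \<comment> \<open>\<open>((i \<in> T) = q) = q\<close> holds exactly if
      \<open>i \<in> T\<close>, so the second coordinate of \<open>\<gamma>\<close> selects
      \<open>T\<close> whichever truth value \<open>q\<close> is.\<close>
    define \<gamma> where "\<gamma> i = (fst (h i), (i \<in> T) = q)" for i
    have \<gamma>: "\<gamma> i = h i" if "i \<in> T \<longleftrightarrow> snd (h i) = q" for i
      using that by (cases "h i") (auto simp: \<gamma>_def)
    have "\<gamma> i = s ! i" if "i < length s" for i
    proof -
      have "i \<in> T \<inter> {..<k 0} \<longleftrightarrow> i \<in> {i. snd (h i) = q} \<inter> {..<k 0}" by (simp only: init)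
      then have "i \<in> T \<longleftrightarrow> snd (h i) = q" using that k(2) by simp
      then show ?thesis using \<gamma> that by (simp add: h_def)
    qed
    then have "\<gamma> \<in> cyl s" by (simp add: cyl_def)
    moreover have "\<exists>\<^sub>\<infinity>n. \<forall>i\<in>{k n..<k (Suc n)}. \<gamma> i = g i"
      using blocks
    proof (rule INFM_mono, intro ballI)
      fix n i assume eq: "T \<inter> {k n..<k (Suc n)} = {i. snd (h i) = q} \<inter> {k n..<k (Suc n)}"
        and i: "i \<in> {k n..<k (Suc n)}"
      have "i \<in> T \<inter> {k n..<k (Suc n)} \<longleftrightarrow> i \<in> {i. snd (h i) = q} \<inter> {k n..<k (Suc n)}"
        by (simp only: eq)
      then have "i \<in> T \<longleftrightarrow> snd (h i) = q" using i by simp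
      then show "\<gamma> i = g i" using \<gamma> h[OF i] by simp
    qed
    ultimately have "\<exists>w. R \<gamma> w" using g by blast
    then have "biso (real N) (X {i. fst (\<gamma> i) = p}) (X {i. snd (\<gamma> i) = q})" by (simp add: R_iff)
    moreover have "{i. snd (\<gamma> i) = q} = T" by (auto simp: \<gamma>_def)
    ultimately show ?thesis by (simp add: \<gamma>_def)
  qed
  then show ?thesis
    using k(1) by (intro exI[of _ "{i. fst (h i) = p}"] exI[of _ "{i. snd (h i) = q}"]
        exI[of _ "real N"] exI[of _ k]) simp
qed

section \<open>Absorption of partial sums\<close>

lemma unif_biso_union:
  assumes "\<And>i. i \<in> \<I> \<Longrightarrow> A i \<inter> B i = {}"
  shows "unif_biso \<I> (\<lambda>i. X (A i \<union> B i)) (\<lambda>i. X (A i) \<times> X (B i))"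
  using biso_disjoint_union assms unfolding unif_biso_def by meson

text \<open>Keeping \<open>c\<close> on \<open>Q\<close> already meets the requirements on
  \<open>T\<close>, so any \<open>I - Q\<close> may be added with the same constant. The summand
  \<open>X (c \<inter> Q)\<close> left after splitting is again a copy of
  \<open>X J\<close>.\<close>

lemma unif_biso_absorb:
  assumes K: "\<forall>T. T \<inter> {..<k 0} = c \<inter> {..<k 0} \<longrightarrow>
      (\<exists>\<^sub>\<infinity>n. T \<inter> {k n..<k (Suc n)} = c \<inter> {k n..<k (Suc n)}) \<longrightarrow> biso K (X J) (X T)"
    and Q: "{..<k 0} \<subseteq> Q" "\<exists>\<^sub>\<infinity>n. {k n..<k (Suc n)} \<subseteq> Q"
  shows "unif_biso \<I> (\<lambda>I. X J) (\<lambda>I. X J \<times> X (I - Q))"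
proof -
  have absorb: "biso K (X J) (X (c \<inter> Q \<union> (I - Q)))" for I
  proof (rule K[rule_format])
    show "(c \<inter> Q \<union> (I - Q)) \<inter> {..<k 0} = c \<inter> {..<k 0}" using Q(1) by blast
    show "\<exists>\<^sub>\<infinity>n. (c \<inter> Q \<union> (I - Q)) \<inter> {k n..<k (Suc n)} = c \<inter> {k n..<k (Suc n)}"
      using Q(2) by (rule INFM_mono) blast
  qed
  then have "unif_biso \<I> (\<lambda>I. X J) (\<lambda>I. X (c \<inter> Q \<union> (I - Q)))"
    by (auto simp: unif_biso_def)
  also have "unif_biso \<I> \<dots> (\<lambda>I. X (c \<inter> Q) \<times> X (I - Q))"
    by (rule unif_biso_union) blast
  also have "unif_biso \<I> \<dots> (\<lambda>I. X J \<times> X (I - Q))"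
  proof (intro unif_biso_times unif_biso_refl subspace_X)
    \<comment> \<open>The choice \<open>I = Q\<close> adds nothing to
      \<open>c \<inter> Q\<close>.\<close>
    have "biso K (X (c \<inter> Q)) (X J)" using absorb[of Q] biso_sym by fastforce
    then show "unif_biso \<I> (\<lambda>I. X (c \<inter> Q)) (\<lambda>I. X J)" by (auto simp: unif_biso_def)
  qed
  finally show ?thesis .
qed

end

theorem theorem2p6:
  fixes E :: "nat \<Rightarrow> 'a::banach set"
  assumes separable: "\<exists>D :: 'a set. countable D \<and> closure D = UNIV"
    and unconditional: "unconditional_decomposition E"
    and not_perfect: "\<not> perfect_decomposition E"
  shows "\<exists>(N::nat) (K::real). K \<ge> 1 \<and>
    (\<forall>I. I \<subseteq> {N..} \<longrightarrow>
      K_isomorphic K (UNIV :: 'a set) ((UNIV :: 'a set) \<times> partial_sum_space E I))"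
proof -
  interpret unconditional E by (rule unconditional.intro[OF unconditional])
  obtain J c K and k :: "nat \<Rightarrow> nat" where k: "strict_mono k"
    and K: "\<forall>T. T \<inter> {..<k 0} = c \<inter> {..<k 0} \<longrightarrow>
      (\<exists>\<^sub>\<infinity>n. T \<inter> {k n..<k (Suc n)} = c \<inter> {k n..<k (Suc n)}) \<longrightarrow> biso K (X J) (X T)"
    using generic_subspace[OF separable not_perfect] by (elim exE conjE) (rule that)
  \<comment> \<open>Both \<open>Q\<close> and \<open>Q'\<close> contain the initial segment, as
    absorption demands, and together they cover all indices. Beyond \<open>k 0\<close> they are
    complementary, so \<open>I - Q\<close> and \<open>I - Q'\<close> partition every
    \<open>I\<close> in \<open>{k 0..}\<close>; this is why \<open>N\<close> is
    \<open>k 0\<close>.\<close>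
  define Q where "Q = {..<k 0} \<union> (\<Union>n\<in>{n. even n}. {k n..<k (Suc n)})"
  define Q' where "Q' = {..<k 0} \<union> - Q"
  have even_Q: "{k n..<k (Suc n)} \<subseteq> Q" if "even n" for n
    unfolding Q_def using that by blast
  have odd_Q': "{k n..<k (Suc n)} \<subseteq> Q'" if n: "odd n" for n
  proof -
    have "i \<notin> Q" if i: "i \<in> {k n..<k (Suc n)}" for i
    proof
      assume "i \<in> Q"
      moreover have "k 0 \<le> i" using i strict_mono_less_eq[OF k, of 0 n] by simp
      ultimately obtain m where m: "even m" "i \<in> {k m..<k (Suc m)}" by (auto simp: Q_def)
      then have "k m < k (Suc n)" "k n < k (Suc m)" using i by auto
      then have "m = n" using strict_mono_less[OF k] by simp
      then show False using m(1) n by simp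
    qed
    then show ?thesis by (auto simp: Q'_def)
  qed
  have inf: "\<exists>\<^sub>\<infinity>n. {k n..<k (Suc n)} \<subseteq> Q" "\<exists>\<^sub>\<infinity>n. {k n..<k (Suc n)} \<subseteq> Q'"
  proof -
    have "\<exists>n>m. {k n..<k (Suc n)} \<subseteq> Q" for m
      using even_Q[of "2 * m + 2"] by (intro exI[of _ "2 * m + 2"]) simp
    then show "\<exists>\<^sub>\<infinity>n. {k n..<k (Suc n)} \<subseteq> Q" by (simp add: INFM_nat)
    have "\<exists>n>m. {k n..<k (Suc n)} \<subseteq> Q'" for m
      using odd_Q'[of "2 * m + 1"] by (intro exI[of _ "2 * m + 1"]) simp
    then show "\<exists>\<^sub>\<infinity>n. {k n..<k (Suc n)} \<subseteq> Q'" by (simp add: INFM_nat)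
  qed
  have absorb: "unif_biso (Pow {k 0..}) (\<lambda>I. X J) (\<lambda>I. X J \<times> X (I - Q))"
    by (rule unif_biso_absorb[OF K _ inf(1)]) (simp add: Q_def)
  have absorb': "unif_biso (Pow {k 0..}) (\<lambda>I. X J) (\<lambda>I. X J \<times> X (I - Q'))"
    by (rule unif_biso_absorb[OF K _ inf(2)]) (simp add: Q'_def)
  let ?\<I> = "Pow {k 0..}"
  note refl = unif_biso_refl[OF subspace_X, where \<I> = ?\<I>]
  \<comment> \<open>\<open>T = c\<close> matches the pattern everywhere, so \<open>X c\<close> is a
    copy of \<open>X J\<close>, and \<open>X Z\<close> is a complement of it in the whole
    space.\<close>
  define Z where "Z = - (c :: nat set)"
  have "unif_biso ?\<I> (\<lambda>I. X (c \<union> Z)) (\<lambda>I. X c \<times> X Z)"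
    by (rule unif_biso_union) (simp add: Z_def)
  also have "unif_biso ?\<I> \<dots> (\<lambda>I. X J \<times> X Z)"
  proof (intro unif_biso_times refl)
    have "biso K (X c) (X J)" by (rule biso_sym, rule K[rule_format]) (simp_all add: INFM_nat gt_ex)
    then show "unif_biso ?\<I> (\<lambda>I. X c) (\<lambda>I. X J)" by (auto simp: unif_biso_def)
  qed
  finally have XJZ: "unif_biso ?\<I> (\<lambda>I. UNIV :: 'a set) (\<lambda>I. X J \<times> X Z)"
    by (simp add: Z_def X_UNIV)
  have "unif_biso ?\<I> (\<lambda>I. X J) (\<lambda>I. X J \<times> X I)"
  proof -
    have "unif_biso ?\<I> (\<lambda>I. X J) (\<lambda>I. X J \<times> X (I - Q'))" by (rule absorb')
    also have "unif_biso ?\<I> \<dots> (\<lambda>I. (X J \<times> X (I - Q)) \<times> X (I - Q'))"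
      by (intro unif_biso_times absorb refl)
    also have "unif_biso ?\<I> \<dots> (\<lambda>I. X J \<times> (X (I - Q) \<times> X (I - Q')))"
      by (intro unif_biso_times_assoc subspace_X)
    also have "unif_biso ?\<I> \<dots> (\<lambda>I. X J \<times> X ((I - Q) \<union> (I - Q')))"
      by (rule unif_biso_times[OF refl unif_biso_sym[OF unif_biso_union]]) (auto simp: Q'_def)
    finally have "unif_biso ?\<I> (\<lambda>I. X J) (\<lambda>I. X J \<times> X ((I - Q) \<union> (I - Q')))" .
    moreover have "(I - Q) \<union> (I - Q') = I" if "I \<in> ?\<I>" for I
      using that by (auto simp: Q'_def)
    ultimately show ?thesis by (simp add: unif_biso_def)
  qed
  note absorb_I = this
  \<comment> \<open>The factor \<open>X J\<close> absorbs \<open>X I\<close>; moving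
    \<open>X I\<close> to the end restores \<open>X J \<times> X Z\<close>, which is the whole space
    again.\<close>
  note XJZ
  also have "unif_biso ?\<I> (\<lambda>I. X J \<times> X Z) (\<lambda>I. (X J \<times> X I) \<times> X Z)"
    by (intro unif_biso_times absorb_I refl)
  also have "unif_biso ?\<I> \<dots> (\<lambda>I. (X J \<times> X Z) \<times> X I)"
    by (intro unif_biso_times_right_commute subspace_X)
  also have "unif_biso ?\<I> \<dots> (\<lambda>I. (UNIV :: 'a set) \<times> X I)"
    by (intro unif_biso_times refl unif_biso_sym[OF XJZ])
  finally obtain L where L: "L \<ge> 1" "\<And>M I. M \<ge> L \<Longrightarrow> I \<in> ?\<I> \<Longrightarrow> biso M (UNIV :: 'a set) ((UNIV :: 'a set) \<times> X I)"
    by (rule unif_bisoE) blast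
  \<comment> \<open>The map and its inverse both have norm at most \<open>L\<close>, whence the
    square.\<close>
  have "K_isomorphic (L * L) (UNIV :: 'a set) ((UNIV :: 'a set) \<times> X I)" if "I \<subseteq> {k 0..}" for I
    by (rule biso_imp_K_isomorphic[OF L(2)]) (use that L(1) in auto)
  moreover have "L * L \<ge> 1" using L(1) mult_mono[of 1 L 1 L] by simp
  ultimately show ?thesis by blast
qed

end
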